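(* Let $q$ be a prime power and let $r>1$ and $n\ge1$ be integers. Then $$\zeta_A(q^n-1,(q-1)q^n,\dots,(q-1)q^{n+r-2})=\zeta_A(q^n-1)\,\zeta_A(q-1,(q-1)q,\dots,(q-1)q^{r-2})^{q^n}-\zeta_A(q^{n+1}-1,(q-1)q^{n+1},\dots,(q-1)q^{n+r-2}),$$ where the last multizeta value has depth $r-1$ (for $r=2$ it is $\zeta_A(q^{n+1}-1)$). Moreover, $$\zeta_A(q^n-1,(q-1)q^n,\dots,(q-1)q^{n+r-2})=\frac{(-1)^{n+r-1}[n+r-2][n+r-3]\cdots[n]}{\prod_{k=1}^{r-1}[k]^{q^{n+r-1-k}}\;L_{n+r-1}}\,\tilde\pi^{\,q^{n+r-1}-1}=\frac{[n+r-2][n+r-3]\cdots[n]}{\prod_{k=1}^{r-1}[k]^{q^{n+r-1-k}}}\,\zeta_A(q^{n+r-1}-1).$$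
   Context: $A=\mathbb{F}_q[\theta]$, $A_+$ the monic polynomials, $[k]=\theta^{q^k}-\theta$, $L_k=[k][k-1]\cdots[1]$. For $s\in\mathbb{Z}$, $d\ge0$ let $S_d(s)=\sum_{a\in A_+,\deg a=d}a^{-s}$. For positive integers $s_1,\dots,s_r$, $\zeta_A(s_1,\dots,s_r)=\sum_{d_1>\cdots>d_r\ge0}S_{d_1}(s_1)\cdots S_{d_r}(s_r)\in\mathbb{F}_q((1/\theta))$, and $\zeta_A(k)=\sum_{a\in A_+}a^{-k}$. $\tilde\pi=(-\theta)^{q/(q-1)}\prod_{i\ge1}(1-\theta^{1-q^i})^{-1}$ is a fundamental period of the Carlitz module (for a fixed choice of $(q-1)$-th root of $-\theta$). *)

theory Defs
  imports "HOL-Analysis.Analysis" "HOL-Algebra.Algebraic_Closure_Type"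
begin

text \<open>
  A finite field \<open>\<bbbF>\<^sub>q\<close> is a type \<open>'a :: {field, finite}\<close> with \<open>q = CARD('a)\<close>. The completion
  \<open>\<bbbF>\<^sub>q((1/\<theta>))\<close> is the type \<open>'a fls\<close>, the variable of the Laurent series being \<open>1/\<theta>\<close>; its
  library metric induces the \<open>1/\<theta>\<close>-adic topology.
\<close>

definition theta :: "'a::{field, finite} fls"
  where "theta = fls_X_inv"

definition of_A :: "'a::{field, finite} poly \<Rightarrow> 'a fls"
  where "of_A a = poly (map_poly fls_const a) theta"

definition A_plus :: "'a::{field, finite} poly set"
  where "A_plus = {a. Polynomial.lead_coeff a = 1}"

definition bracket :: "nat \<Rightarrow> 'a::{field, finite} fls"
  where "bracket k = theta ^ (CARD('a) ^ k) - theta"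

definition carlitz_L :: "nat \<Rightarrow> 'a::{field, finite} fls"
  where "carlitz_L k = (\<Prod>j = 1..k. bracket j)"

definition power_sum :: "nat \<Rightarrow> int \<Rightarrow> 'a::{field, finite} fls"
  where "power_sum d s = (\<Sum>a \<in> {a \<in> A_plus. Polynomial.degree a = d}. of_A a powi (- s))"

definition mzeta :: "nat list \<Rightarrow> 'a::{field, finite} fls"
  where "mzeta ss =
    infsum (\<lambda>ds. \<Prod>i<length ss. power_sum (ds ! i) (int (ss ! i)))
      {ds :: nat list. length ds = length ss \<and> sorted_wrt (>) ds}"

definition zeta :: "nat \<Rightarrow> 'a::{field, finite} fls"
  where "zeta k = infsum (\<lambda>a. of_A a powi (- int k)) A_plus"

text \<open>
  The period depends on the choice of a \<open>(q - 1)\<close>-th root \<open>\<rho>\<close> of \<open>-\<theta>\<close>, which in general only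
  exists in an extension of \<open>\<bbbF>\<^sub>q((1/\<theta>))\<close>; \<open>(-\<theta>)\<close> to the power \<open>q / (q - 1)\<close> is \<open>\<rho> ^ q\<close>.
\<close>

definition carlitz_period :: "'a::{field, finite} fls alg_closure \<Rightarrow> 'a fls alg_closure"
  where "carlitz_period \<rho> = \<rho> ^ CARD('a) *
    to_ac (\<Prod>i. inverse (1 - theta powi (1 - int CARD('a) ^ Suc i)))"


subsection \<open>Convergence, and agreement of the two definitions in depth one\<close>

unbundle fps_syntax

definition val_ge :: "'a::{field, finite} fls \<Rightarrow> int \<Rightarrow> bool"
  where "val_ge f n \<longleftrightarrow> (\<forall>m<n. f $$ m = 0)"

lemma val_ge_alt: "val_ge f n \<longleftrightarrow> f = 0 \<or> fls_subdegree f \<ge> n"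
proof -
  have "fls_subdegree f \<ge> n" if "val_ge f n" "f \<noteq> 0"
    using that nth_fls_subdegree_nonzero[of f] unfolding val_ge_def by (meson not_le)
  thus ?thesis by (auto simp: val_ge_def)
qed

lemma val_ge_mult: "val_ge f a \<Longrightarrow> val_ge g b \<Longrightarrow> val_ge (f * g) (a + b)"
  by (cases "f = 0 \<or> g = 0") (auto simp: val_ge_alt)

lemma val_ge_mono: "val_ge f a \<Longrightarrow> b \<le> a \<Longrightarrow> val_ge f b"
  by (auto simp: val_ge_def)

lemma fls_nth_sum': "(\<Sum>i\<in>A. f i) $$ n = (\<Sum>i\<in>A. f i $$ n)"
  by (induction A rule: infinite_finite_induct) auto

lemma val_ge_sum: "(\<And>i. i \<in> A \<Longrightarrow> val_ge (f i) n) \<Longrightarrow> val_ge (\<Sum>i\<in>A. f i) n"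
  by (auto simp: val_ge_def fls_nth_sum')

lemma val_ge_prod:
  assumes "finite A" "\<And>i. i \<in> A \<Longrightarrow> val_ge (f i) (n i)"
  shows "val_ge (\<Prod>i\<in>A. f i) (\<Sum>i\<in>A. n i)"
  using assms
proof (induction A rule: finite_induct)
  case empty
  show ?case by (simp add: val_ge_def)
next
  case (insert x F)
  thus ?case by (simp add: val_ge_mult)
qed

lemma val_ge_dist:
  assumes "val_ge (f - g) (int N)"
  shows "dist f g \<le> inverse (2 ^ N)"
proof (cases "f = g")
  case False
  hence "fls_subdegree (f - g) \<ge> int N" using assms by (auto simp: val_ge_alt)
  thus ?thesis using False by (auto simp: dist_fls_def intro!: le_imp_inverse_le power_increasing)
qed auto

lemma fls_has_sumI:
  fixes f :: "'i \<Rightarrow> 'a::{field, finite} fls"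
  assumes fin: "\<And>N. finite {i\<in>I. \<not> val_ge (f i) N}"
    and s: "\<And>n. s $$ n = (\<Sum>i | i \<in> I \<and> f i $$ n \<noteq> 0. f i $$ n)"
  shows "(f has_sum s) I"
  unfolding has_sum_def tendsto_iff
proof (intro allI impI)
  fix e :: real assume "e > 0"
  obtain N where N: "inverse (2 ^ N) < e"
    using real_arch_pow_inv[of e "1/2"] \<open>e > 0\<close> by (auto simp: power_one_over inverse_eq_divide)
  let ?F0 = "{i\<in>I. \<not> val_ge (f i) (int N)}"
  have "dist (sum f F) s < e" if F: "finite F" "?F0 \<subseteq> F" "F \<subseteq> I" for F
  proof -
    have "val_ge (sum f F - s) (int N)"
      unfolding val_ge_def
    proof (intro allI impI)
      fix m assume m: "m < int N"
      have "(\<Sum>i | i \<in> I \<and> f i $$ m \<noteq> 0. f i $$ m) = (\<Sum>i\<in>F. f i $$ m)"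
        using F m by (intro sum.mono_neutral_left) (auto simp: val_ge_def)
      thus "(sum f F - s) $$ m = 0" by (simp add: s fls_nth_sum')
    qed
    thus ?thesis using val_ge_dist N by (meson le_less_trans)
  qed
  thus "\<forall>\<^sub>F x in finite_subsets_at_top I. dist (sum f x) s < e"
    unfolding eventually_finite_subsets_at_top
    by (intro exI[of _ ?F0]) (use fin in auto)
qed

lemma fls_summable_onI:
  fixes f :: "'i \<Rightarrow> 'a::{field, finite} fls"
  assumes fin: "\<And>N. finite {i\<in>I. \<not> val_ge (f i) N}"
  shows "f summable_on I"
    and "infsum f I $$ n = (\<Sum>i | i \<in> I \<and> f i $$ n \<noteq> 0. f i $$ n)"
proof -
  define F0 where "F0 = {i\<in>I. \<not> val_ge (f i) 0}"
  define s where "s = (\<Sum>i\<in>F0. f i) +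
    fps_to_fls (Abs_fps (\<lambda>n. \<Sum>i | i \<in> I - F0 \<and> f i $$ int n \<noteq> 0. f i $$ int n))"
  have finn: "finite {i\<in>I. f i $$ n \<noteq> 0}" for n
    by (rule finite_subset[OF _ fin[of "n + 1"]]) (auto simp: val_ge_def)
  have F0: "finite F0" using fin by (auto simp: F0_def)
  have s: "s $$ n = (\<Sum>i | i \<in> I \<and> f i $$ n \<noteq> 0. f i $$ n)" for n
  proof -
    have "(\<Sum>i\<in>F0. f i $$ n) = (\<Sum>i | i \<in> F0 \<and> f i $$ n \<noteq> 0. f i $$ n)"
      by (rule sum.mono_neutral_right) (use F0 in auto)
    moreover have "(\<Sum>i | i \<in> I \<and> f i $$ n \<noteq> 0. f i $$ n) =
        (\<Sum>i | i \<in> F0 \<and> f i $$ n \<noteq> 0. f i $$ n) + (\<Sum>i | i \<in> I - F0 \<and> f i $$ n \<noteq> 0. f i $$ n)"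
      by (subst sum.union_disjoint [symmetric])
        (auto intro!: sum.cong finite_subset[OF _ finn[of n]] simp: F0_def)
    moreover have "{i. i \<in> I - F0 \<and> f i $$ n \<noteq> 0} = {}" if "n < 0"
      using that by (auto simp: F0_def val_ge_def)
    ultimately show ?thesis
      by (cases "n \<ge> 0") (simp_all only: s_def fls_nth_sum' fls_plus_nth fps_to_fls_nth
        fps_nth_Abs_fps nat_0_le sum.empty not_le if_True if_False simp_thms, auto)
  qed
  have "(f has_sum s) I" by (rule fls_has_sumI[OF fin s])
  thus "f summable_on I" "infsum f I $$ n = (\<Sum>i | i \<in> I \<and> f i $$ n \<noteq> 0. f i $$ n)"
    using infsumI[of f I s] by (auto simp only: summable_on_def s)
qed

lemma of_A_nth: "of_A a $$ n = (if n \<le> 0 then Polynomial.coeff a (nat (- n)) else 0)"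
proof -
  have *: "(fls_const c * fls_X_inv ^ i) $$ n = (if n = - int i then c else 0)" for c :: 'a and i
    by (simp add: fls_X_inv_power_conv_shift_1)
  have "of_A a $$ n = (\<Sum>i\<le>Polynomial.degree a. if n = - int i then Polynomial.coeff a i else 0)"
    by (simp add: of_A_def theta_def poly_altdef fls_nth_sum' * coeff_map_poly degree_map_poly
      del: fls_mult_const_nth)
  also have "\<dots> = (if n \<le> 0 then Polynomial.coeff a (nat (- n)) else 0)"
  proof (cases "n \<le> 0")
    case True
    then obtain m where "n = - int m" by (metis add.inverse_inverse neg_0_le_iff_le nonneg_int_cases)
    thus ?thesis by (simp add: coeff_eq_0 not_le)
  next
    case False
    thus ?thesis by (auto intro!: sum.neutral)
  qed
  finally show ?thesis .
qed

lemma of_A_subdegree: "a \<noteq> 0 \<Longrightarrow> fls_subdegree (of_A a) = - int (Polynomial.degree a)"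
  by (rule fls_subdegree_eqI) (auto simp: of_A_nth coeff_eq_0)

lemma val_ge_of_A: "a \<noteq> 0 \<Longrightarrow> val_ge (of_A a powi (- int k)) (int (Polynomial.degree a * k))"
  by (simp add: val_ge_alt of_A_subdegree power_int_minus fls_subdegree_pow)

lemma val_ge_power_sum: "val_ge (power_sum d (int k)) (int (d * k))"
  unfolding power_sum_def
proof (rule val_ge_sum)
  fix a :: "'a poly" assume "a \<in> {a \<in> A_plus. Polynomial.degree a = d}"
  thus "val_ge (of_A a powi (- int k)) (int (d * k))"
    using val_ge_of_A[of a k] by (cases "a = 0") (auto simp: A_plus_def)
qed

lemma finite_degree_le: "finite {a :: 'a::{field, finite} poly. Polynomial.degree a \<le> n}"
proof (rule finite_subset)
  show "{a :: 'a poly. Polynomial.degree a \<le> n} \<subseteq> Poly ` {xs. set xs \<subseteq> UNIV \<and> length xs \<le> Suc n}"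
  proof
    fix a :: "'a poly" assume "a \<in> {a. Polynomial.degree a \<le> n}"
    hence "length (coeffs a) \<le> Suc n" by (cases "a = 0") (auto simp: length_coeffs_degree)
    thus "a \<in> Poly ` {xs. set xs \<subseteq> UNIV \<and> length xs \<le> Suc n}"
      by (intro image_eqI[of _ _ "coeffs a"]) auto
  qed
qed (intro finite_imageI finite_lists_length_le, auto)

lemma finite_not_val_ge_of_A:
  assumes "k > 0"
  shows "finite {a \<in> A_plus. \<not> val_ge (of_A a powi (- int k) :: 'a::{field, finite} fls) N}"
proof (rule finite_subset[OF _ finite_degree_le[of "nat N"]], safe)
  fix a :: "'a poly" assume a: "a \<in> A_plus" "\<not> val_ge (of_A a powi (- int k)) N"
  hence "int (Polynomial.degree a * k) < N"
    using val_ge_mono[OF val_ge_of_A[of a k], of N] by (force simp: A_plus_def)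
  moreover have "Polynomial.degree a \<le> Polynomial.degree a * k" using assms by simp
  ultimately show "Polynomial.degree a \<le> nat N" by linarith
qed

lemma finite_not_val_ge_mzeta:
  assumes "\<And>s. s \<in> set ss \<Longrightarrow> s > 0"
  shows "finite {ds \<in> {ds. length ds = length ss \<and> sorted_wrt (>) ds}.
    \<not> val_ge (\<Prod>i<length ss. power_sum (ds ! i) (int (ss ! i)) :: 'a::{field, finite} fls) N}"
proof (rule finite_subset)
  show "finite {ds. set ds \<subseteq> {..nat N} \<and> length ds = length ss}"
    by (intro finite_lists_length_eq) auto
  show "{ds \<in> {ds. length ds = length ss \<and> sorted_wrt (>) ds}.
    \<not> val_ge (\<Prod>i<length ss. power_sum (ds ! i) (int (ss ! i)) :: 'a fls) N} \<subseteq>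
    {ds. set ds \<subseteq> {..nat N} \<and> length ds = length ss}"
  proof safe
    fix ds d assume ds: "length ds = length ss" "d \<in> set ds"
      "\<not> val_ge (\<Prod>i<length ss. power_sum (ds ! i) (int (ss ! i)) :: 'a fls) N"
    obtain j where j: "j < length ss" "d = ds ! j" using ds by (auto simp: in_set_conv_nth)
    have "val_ge (\<Prod>i<length ss. power_sum (ds ! i) (int (ss ! i)) :: 'a fls)
        (\<Sum>i<length ss. int (ds ! i * ss ! i))"
      by (intro val_ge_prod val_ge_power_sum) auto
    hence "(\<Sum>i<length ss. int (ds ! i * ss ! i)) < N"
      using ds(3) val_ge_mono by (meson not_le)
    moreover have "int (ds ! j * ss ! j) \<le> (\<Sum>i<length ss. int (ds ! i * ss ! i))"
      using j by (intro member_le_sum) auto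
    moreover have "d \<le> ds ! j * ss ! j" using j assms[of "ss ! j"] by auto
    ultimately show "d \<le> nat N" by linarith
  qed
qed

lemma mzeta_summable:
  assumes "\<And>s. s \<in> set ss \<Longrightarrow> s > 0"
  shows "(\<lambda>ds. \<Prod>i<length ss. power_sum (ds ! i) (int (ss ! i)) :: 'a::{field, finite} fls) summable_on
    {ds. length ds = length ss \<and> sorted_wrt (>) ds}"
  by (rule fls_summable_onI(1)[OF finite_not_val_ge_mzeta[OF assms]])

lemma zeta_summable:
  assumes "k > 0"
  shows "(\<lambda>a. of_A a powi (- int k) :: 'a::{field, finite} fls) summable_on A_plus"
  by (rule fls_summable_onI(1)[OF finite_not_val_ge_of_A[OF assms]])

lemma mzeta_depth_one:
  assumes "k > 0"
  shows "mzeta [k] = (zeta k :: 'a::{field, finite} fls)"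
proof (rule fls_eqI)
  fix n :: int
  define f where "f = (\<lambda>a :: 'a poly. of_A a powi (- int k))"
  define I where "I = {ds :: nat list. length ds = length [k] \<and> sorted_wrt (>) ds}"
  define g where "g = (\<lambda>ds. \<Prod>i<length [k]. power_sum (ds ! i) (int ([k] ! i)) :: 'a fls)"
  have fin': "finite {a :: 'a poly. a \<in> A_plus \<and> Polynomial.degree a \<le> d}" for d
    by (rule finite_subset[OF _ finite_degree_le[of d]]) auto
  have nz: "d \<le> nat n" if "\<not> val_ge x (n + 1)" "val_ge x (int (d * k))" for x :: "'a fls" and d
  proof -
    have "int (d * k) < n + 1" using that val_ge_mono by (meson not_le)
    moreover have "d \<le> d * k" using assms by simp
    ultimately show ?thesis by linarith
  qed
  have g: "g [d] = power_sum d (int k)" for d by (simp add: g_def)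
  have I: "I = (\<lambda>d. [d]) ` UNIV"
    by (auto simp: I_def length_Suc_conv)
  have "mzeta [k] $$ n = (\<Sum>ds | ds \<in> I \<and> g ds $$ n \<noteq> 0. g ds $$ n)"
    unfolding mzeta_def I_def g_def
    by (rule fls_summable_onI(2)[OF finite_not_val_ge_mzeta]) (use assms in auto)
  also have "\<dots> = (\<Sum>ds\<in>(\<lambda>d. [d]) ` {..nat n}. g ds $$ n)"
    by (rule sum.mono_neutral_left)
      (auto simp: I g intro!: imageI nz[OF _ val_ge_power_sum], auto simp: val_ge_def)
  also have "\<dots> = (\<Sum>d\<le>nat n. power_sum d (int k) $$ n)"
    by (subst sum.reindex) (auto simp: inj_on_def g)
  also have "\<dots> = (\<Sum>d\<le>nat n. \<Sum>a | a \<in> {a \<in> A_plus. Polynomial.degree a \<le> nat n} \<and> Polynomial.degree a = d. f a $$ n)"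
    by (auto simp: power_sum_def fls_nth_sum' f_def intro!: sum.cong)
  also have "\<dots> = (\<Sum>a | a \<in> A_plus \<and> Polynomial.degree a \<le> nat n. f a $$ n)"
    by (rule sum.group) (auto simp: fin')
  also have "\<dots> = (\<Sum>a | a \<in> A_plus \<and> f a $$ n \<noteq> 0. f a $$ n)"
  proof (rule sum.mono_neutral_right)
    show "{a \<in> A_plus. f a $$ n \<noteq> 0} \<subseteq> {a \<in> A_plus. Polynomial.degree a \<le> nat n}"
    proof safe
      fix a :: "'a poly" assume a: "a \<in> A_plus" "f a $$ n \<noteq> 0"
      hence "a \<noteq> 0" by (auto simp: A_plus_def)
      thus "Polynomial.degree a \<le> nat n"
        using a(2) by (intro nz[OF _ val_ge_of_A[of a k]]) (auto simp: val_ge_def f_def)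
    qed
  qed (auto simp: fin')
  also have "\<dots> = zeta k $$ n"
    unfolding zeta_def f_def
    by (rule fls_summable_onI(2)[OF finite_not_val_ge_of_A[OF assms], symmetric])
  finally show "mzeta [k] $$ n = (zeta k :: 'a fls) $$ n" .
qed

unbundle no fps_syntax

end

theory Submission
  imports Defs
begin

text \<open>
  Write \<open>\<ell>\<^sub>d = (\<theta> - \<theta> ^ q) \<dots> (\<theta> - \<theta> ^ (q ^ d))\<close>. Interpolating \<open>\<Sum> a(t) / a(\<theta>) ^ (q ^ k)\<close>, summed over
  all \<open>a\<close> of degree at most \<open>d\<close>, as a polynomial in \<open>t\<close> at the points \<open>\<theta> ^ (q ^ (k + i))\<close> yields
  \<open>\<Sum>\<^bsub>e \<le> d\<^esub> S\<^sub>e(q ^ k - 1) = \<ell>\<^bsub>k + d\<^esub> / (\<ell>\<^sub>k \<ell>\<^sub>d ^ (q ^ k))\<close>, and taking differences gives \<open>S\<^sub>d(q ^ k - 1)\<close>.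
  Hence \<open>S\<^sub>d((q - 1) q ^ n) \<Sum>\<^bsub>e \<le> d\<^esub> S\<^sub>e(q ^ n - 1) = S\<^sub>d(q ^ (n + 1) - 1)\<close>; splitting the product
  \<open>\<zeta>(q ^ n - 1) \<zeta>((q - 1) q ^ n, \<dots>)\<close> according to whether the first index exceeds the second one,
  this is the recursion in the theorem. In the limit, \<open>\<ell>\<^sub>k \<zeta>(q ^ k - 1) = lim \<ell>\<^bsub>k + d\<^esub> / \<ell>\<^sub>d ^ (q ^ k)\<close>;
  this turns the recursion into \<open>[n] = [n + m] - [m] ^ (q ^ n)\<close>, which gives the closed form by induction
  on the depth, and for \<open>k = 1\<close> it is the product formula for the \<open>(q - 1)\<close>-st power of the period.
\<close>


subsection \<open>Finite fields\<close>

text \<open>Multiplication by a nonzero \<open>x\<close> permutes the nonzero elements, so their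
  product P satisfies x^(q-1) P = P.\<close>

lemma finite_field_power_card:
  fixes x :: "'a::{field, finite}"
  shows "x ^ CARD('a) = x"
proof (cases "x = 0")
  case False
  have "x ^ (CARD('a) - 1) * \<Prod>(UNIV - {0}) = (\<Prod>y\<in>UNIV-{0}. x * y)"
    by (simp add: prod.distrib)
  also have "\<dots> = \<Prod>(UNIV - {0})"
    by (rule prod.reindex_bij_witness[of _ "\<lambda>y. y / x" "\<lambda>y. x * y"]) (use False in auto)
  finally have "x ^ (CARD('a) - 1) = 1" by simp
  thus ?thesis using power_minus_mult[of "CARD('a)" x] by simp
qed simp

lemma finite_field_power_card_power:
  fixes x :: "'a::{field, finite}"
  shows "x ^ (CARD('a) ^ n) = x"
  by (induction n) (simp_all add: power_mult finite_field_power_card)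

lemma card_field_gt_1: "CARD('a::{field, finite}) > 1"
proof -
  have "card {0, 1 :: 'a} \<le> CARD('a)" by (rule card_mono) auto
  thus ?thesis by simp
qed

text \<open>Translation by 1 permutes the field, but adds q times 1 to the sum of all
  elements.\<close>

lemma of_nat_card_field: "(of_nat CARD('a) :: 'a::{field, finite}) = 0"
proof -
  have "(\<Sum>c\<in>UNIV. c + 1) = (\<Sum>c\<in>UNIV. c :: 'a)"
    by (rule sum.reindex_bij_witness[of _ "\<lambda>c. c - 1" "\<lambda>c. c + 1"]) auto
  thus ?thesis by (simp add: sum.distrib)
qed

text \<open>For j = 0 the sum is q = 0. Otherwise, scaling the summation variable by a nonzero
  \<open>g\<close> with g^j \<noteq> 1 multiplies the sum by g^j and also leaves it
  unchanged.\<close>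

lemma sum_powers_finite_field:
  assumes "j < CARD('a::{field, finite}) - 1"
  shows "(\<Sum>c\<in>UNIV. c ^ j :: 'a) = 0"
proof (cases "j = 0")
  case True
  thus ?thesis by (simp add: of_nat_card_field)
next
  case False
  have "\<exists>g::'a. g \<noteq> 0 \<and> g ^ j \<noteq> 1"
  proof (rule ccontr)
    assume *: "\<not> ?thesis"
    \<comment> \<open>X^j and 1 would agree at the q - 1 nonzero points, which are more than the
      degree j.\<close>
    have "Polynomial.monom 1 j = (1 :: 'a poly)"
      by (rule poly_eqI_degree[of "UNIV - {0}"])
        (use * assms in \<open>auto simp: poly_monom Polynomial.degree_monom_eq simp del: One_nat_def\<close>)
    thus False using False Polynomial.degree_monom_eq[of "1::'a" j] by simp
  qed
  then obtain g :: 'a where g: "g \<noteq> 0" "g ^ j \<noteq> 1" by blast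
  have "g ^ j * (\<Sum>c\<in>UNIV. c ^ j) = (\<Sum>c\<in>UNIV. (g * c) ^ j)"
    by (simp add: sum_distrib_left power_mult_distrib)
  also have "\<dots> = (\<Sum>c\<in>UNIV. c ^ j)"
    by (rule sum.reindex_bij_witness[of _ "\<lambda>c. c / g" "\<lambda>c. g * c"]) (use g in auto)
  finally have "(g ^ j - 1) * (\<Sum>c\<in>UNIV. c ^ j) = 0" by (simp add: algebra_simps)
  thus ?thesis using g by simp
qed

text \<open>
  The polynomial \<open>(X + 1)\<^sup>q - X\<^sup>q - 1\<close> has degree less than \<open>q\<close> and vanishes on \<open>\<bbbF>\<^sub>q\<close>, hence is zero.
\<close>
lemma binomial_card_field_eq_0:
  assumes "0 < j" "j < CARD('a::{field, finite})"
  shows "(of_nat (CARD('a) choose j) :: 'a) = 0"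
proof -
  define q where "q = CARD('a)"
  have q: "q > 1" using card_field_gt_1 by (simp add: q_def)
  define p :: "'a poly" where "p = (\<Sum>i\<in>{0<..<q}. Polynomial.monom (of_nat (q choose i)) i)"
  have "Polynomial.degree p \<le> q - 1"
    unfolding p_def by (rule degree_sum_le, simp, rule order.trans[OF Polynomial.degree_monom_le]) auto
  moreover have "poly p x = 0" for x
  proof -
    have "x + 1 = (x + 1) ^ q" by (simp add: q_def finite_field_power_card)
    also have "\<dots> = (\<Sum>i\<in>insert 0 (insert q {0<..<q}). of_nat (q choose i) * x ^ i)"
      unfolding binomial_ring using q by (intro sum.cong) auto
    also have "\<dots> = 1 + x ^ q + poly p x"
      using q by (simp add: p_def poly_sum poly_monom)
    finally show ?thesis by (simp add: q_def finite_field_power_card)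
  qed
  ultimately have "p = 0"
    by (intro poly_eqI_degree[of UNIV]) (use q in \<open>auto simp: q_def\<close>)
  hence "0 = Polynomial.coeff p j" by simp
  also have "\<dots> = of_nat (q choose j)"
    using assms unfolding p_def coeff_sum by (simp add: q_def)
  finally show ?thesis by (simp add: q_def)
qed

section \<open>Additivity of Frobenius powers on Laurent series\<close>

lemma add_power_card_fls:
  fixes x y :: "'a::{field, finite} fls"
  shows "(x + y) ^ CARD('a) = x ^ CARD('a) + y ^ CARD('a)"
proof -
  define q where "q = CARD('a)"
  have q: "q > 1" using card_field_gt_1 by (simp add: q_def)
  have 0: "(of_nat (q choose i) :: 'a fls) = 0" if "i \<in> {0<..<q}" for i
    using that binomial_card_field_eq_0[of i, where ?'a = 'a] by (simp add: fls_of_nat q_def)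
  have "(x + y) ^ q = (\<Sum>i\<in>insert 0 (insert q {0<..<q}). of_nat (q choose i) * x ^ i * y ^ (q - i))"
    unfolding binomial_ring using q by (intro sum.cong) auto
  also have "\<dots> = x ^ q + y ^ q" using q by (simp add: 0)
  finally show ?thesis by (simp add: q_def)
qed

lemma add_power_card_power_fls:
  fixes x y :: "'a::{field, finite} fls"
  shows "(x + y) ^ (CARD('a) ^ n) = x ^ (CARD('a) ^ n) + y ^ (CARD('a) ^ n)"
  by (induction n) (simp_all add: power_mult add_power_card_fls power_Suc2 del: power_Suc)

lemma minus_power_card_power_fls:
  fixes x :: "'a::{field, finite} fls"
  shows "(- x) ^ (CARD('a) ^ n) = - (x ^ (CARD('a) ^ n))"
proof -
  have "0 = (x + - x) ^ (CARD('a) ^ n)" by simp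
  thus ?thesis unfolding add_power_card_power_fls by (simp add: eq_neg_iff_add_eq_0 add.commute)
qed

lemma diff_power_card_power_fls:
  fixes x y :: "'a::{field, finite} fls"
  shows "(x - y) ^ (CARD('a) ^ n) = x ^ (CARD('a) ^ n) - y ^ (CARD('a) ^ n)"
  using add_power_card_power_fls[of x "- y" n] by (simp add: minus_power_card_power_fls)

lemma sum_power_card_power_fls:
  fixes f :: "'i \<Rightarrow> 'a::{field, finite} fls"
  shows "(\<Sum>i\<in>I. f i) ^ (CARD('a) ^ n) = (\<Sum>i\<in>I. f i ^ (CARD('a) ^ n))"
  by (induction I rule: infinite_finite_induct) (simp_all add: add_power_card_power_fls)


subsection \<open>Power sums over polynomials\<close>

text \<open>The point is left free, unlike in \<open>of_A\<close>, because interpolation varies it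
  and a Frobenius power of a(\<theta>) is the value of a at a power of \<theta>.\<close>

definition eval_A :: "'a::{field, finite} poly \<Rightarrow> 'a fls \<Rightarrow> 'a fls"
  where "eval_A a x = poly (map_poly fls_const a) x"

lemma of_A_eq_eval_A: "of_A a = eval_A a theta"
  by (simp add: of_A_def eval_A_def)

lemma eval_A_0 [simp]: "eval_A 0 x = 0"
  by (simp add: eval_A_def)

lemma eval_A_pCons: "eval_A (pCons c a) x = fls_const c + x * eval_A a x"
  by (simp add: eval_A_def map_poly_pCons)

lemma eval_A_smult: "eval_A (Polynomial.smult c a) x = fls_const c * eval_A a x"
  by (induction a) (simp_all add: eval_A_pCons algebra_simps fls_const_mult_const [symmetric] del: fls_const_mult_const)

text \<open>Frobenius respects sums and products and fixes the coefficients, so it acts on the point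
  only.\<close>

lemma eval_A_power_card_power:
  fixes a :: "'a::{field, finite} poly"
  shows "eval_A a x ^ (CARD('a) ^ n) = eval_A a (x ^ (CARD('a) ^ n))"
  by (induction a)
    (simp_all add: eval_A_pCons add_power_card_power_fls power_mult_distrib
      finite_field_power_card_power flip: fls_const_power)

lemma of_A_power_card_power:
  fixes a :: "'a::{field, finite} poly"
  shows "of_A a ^ (CARD('a) ^ n) = eval_A a (theta ^ (CARD('a) ^ n))"
  by (simp add: of_A_eq_eval_A eval_A_power_card_power)

lemma of_A_eq_0_iff [simp]: "of_A a = 0 \<longleftrightarrow> a = 0"
proof
  assume "of_A a = 0"
  show "a = 0"
  proof (rule poly_eqI)
    fix n show "Polynomial.coeff a n = Polynomial.coeff 0 n"
      using of_A_nth[of a "- int n"] \<open>of_A a = 0\<close> by simp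
  qed
qed (simp add: of_A_def)

text \<open>Zero is listed separately because its degree is 0 by convention; this gives an F_q-space
  of dimension d also for d = 0.\<close>

definition A_less :: "nat \<Rightarrow> 'a::{field, finite} poly set"
  where "A_less d = {a. a = 0 \<or> Polynomial.degree a < d}"

lemma A_less_0: "A_less 0 = {0}"
  by (simp add: A_less_def)

lemma A_less_Suc: "A_less (Suc d) = (\<lambda>(c, a). pCons c a) ` (UNIV \<times> A_less d)"
proof (intro equalityI subsetI)
  fix a :: "'a poly" assume a: "a \<in> A_less (Suc d)"
  obtain c b where "a = pCons c b" by (cases a)
  with a show "a \<in> (\<lambda>(c, a). pCons c a) ` (UNIV \<times> A_less d)"
    by (auto simp: A_less_def split: if_splits)
qed (auto simp: A_less_def split: if_splits)

lemma finite_A_less: "finite (A_less d)"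
  by (rule finite_subset[OF _ finite_degree_le[of d]]) (auto simp: A_less_def)

lemma inj_on_pCons: "inj_on (\<lambda>(c, a). pCons c a) M"
  by (auto simp: inj_on_def)

lemma sum_A_less_Suc: "(\<Sum>a\<in>A_less (Suc d). f a) = (\<Sum>a\<in>A_less d. \<Sum>c\<in>UNIV. f (pCons c a))"
  unfolding A_less_Suc
  by (subst sum.reindex[OF inj_on_pCons], subst sum.swap)
    (simp add: sum.cartesian_product case_prod_unfold)

lemma card_A_less: "card (A_less d :: 'a::{field, finite} poly set) = CARD('a) ^ d"
  by (induction d) (simp_all add: A_less_0 A_less_Suc card_image inj_on_pCons card_cartesian_product)

text \<open>
  A Chevalley-type vanishing: the product has degree less than \<open>d (q - 1)\<close> in the \<open>d\<close> coefficients
  of \<open>a\<close>, so every monomial has degree less than \<open>q - 1\<close> in one of them.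
\<close>
lemma sum_A_less_prod_eval_A_eq_0:
  fixes x :: "'s \<Rightarrow> 'a::{field, finite} fls"
  assumes "finite S" "card S < d * (CARD('a) - 1)"
  shows "(\<Sum>a\<in>A_less d. \<Prod>s\<in>S. eval_A a (x s)) = 0"
  using assms
proof (induction d arbitrary: S)
  case (Suc d)
  \<comment> \<open>The constant coefficient c is split off from every factor; T is the set of
    factors that contribute c.\<close>
  have "(\<Sum>a\<in>A_less (Suc d). \<Prod>s\<in>S. eval_A a (x s)) =
      (\<Sum>a\<in>A_less d. \<Sum>c\<in>UNIV. \<Sum>T\<in>Pow S. fls_const (c ^ card T) * (\<Prod>s\<in>S - T. x s * eval_A a (x s)))"
    by (simp add: sum_A_less_Suc eval_A_pCons prod_add Suc.prems fls_const_power)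
  also have "\<dots> = (\<Sum>T\<in>Pow S. \<Sum>a\<in>A_less d. \<Sum>c\<in>UNIV. fls_const (c ^ card T) * (\<Prod>s\<in>S - T. x s * eval_A a (x s)))"
    by (simp add: sum.swap[of _ "Pow S"])
  also have "\<dots> = (\<Sum>T\<in>Pow S. (\<Sum>c\<in>UNIV. fls_const (c ^ card T)) * (\<Prod>s\<in>S - T. x s) *
       (\<Sum>a\<in>A_less d. \<Prod>s\<in>S - T. eval_A a (x s)))"
    by (simp add: sum_distrib_left sum_distrib_right prod.distrib mult.assoc)
  also have "\<dots> = 0"
  proof (rule sum.neutral, rule ballI)
    \<comment> \<open>Either the sum over c vanishes, or T uses up at least q - 1 factors and those
      left are few enough for the induction hypothesis.\<close>
    fix T assume T: "T \<in> Pow S"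
    show "(\<Sum>c\<in>UNIV. fls_const ((c::'a) ^ card T)) * (\<Prod>s\<in>S - T. x s) *
       (\<Sum>a\<in>A_less d. \<Prod>s\<in>S - T. eval_A a (x s)) = 0"
    proof (cases "card T < CARD('a) - 1")
      case True
      have "(\<Sum>c\<in>B. fls_const ((c::'a) ^ card T)) = fls_const (\<Sum>c\<in>B. c ^ card T)" for B
        by (induction B rule: infinite_finite_induct) (auto simp: fls_plus_const)
      thus ?thesis using sum_powers_finite_field[OF True] by simp
    next
      case False
      have "card (S - T) = card S - card T"
        using T Suc.prems finite_subset by (intro card_Diff_subset) auto
      hence "card (S - T) < d * (CARD('a) - 1)"
        using False Suc.prems(2) card_mono[of S T] T Suc.prems(1) by auto
      thus ?thesis using Suc.IH[of "S - T"] Suc.prems by simp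
    qed
  qed
  finally show ?case .
qed simp

section \<open>Interpolation at Frobenius powers of \<theta>\<close>

definition carlitz_ell :: "nat \<Rightarrow> 'a::{field, finite} fls"
  where "carlitz_ell k = (\<Prod>i = 1..k. theta - theta ^ (CARD('a) ^ i))"

lemma carlitz_ell_0 [simp]: "carlitz_ell 0 = 1"
  by (simp add: carlitz_ell_def)

lemma carlitz_ell_Suc:
  "carlitz_ell (Suc k) = (carlitz_ell k * (theta - theta ^ (CARD('a) ^ Suc k)) :: 'a::{field, finite} fls)"
  by (simp add: carlitz_ell_def)

lemma theta_power_eq_iff: "theta ^ m = (theta ^ n :: 'a::{field, finite} fls) \<longleftrightarrow> m = n"
proof
  assume "theta ^ m = (theta ^ n :: 'a fls)"
  hence "fls_subdegree (theta ^ m :: 'a fls) = fls_subdegree (theta ^ n :: 'a fls)" by simp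
  thus "m = n" by (simp add: theta_def fls_subdegree_pow)
qed simp

lemma theta_neq_power_card:
  assumes "i > 0"
  shows "theta \<noteq> (theta ^ (CARD('a) ^ i) :: 'a::{field, finite} fls)"
proof -
  have "1 < CARD('a) ^ i" using one_less_power[OF card_field_gt_1 assms] .
  thus ?thesis using theta_power_eq_iff[of 1 "CARD('a) ^ i", where ?'a = 'a] by simp
qed

lemma carlitz_ell_nonzero: "carlitz_ell k \<noteq> (0 :: 'a::{field, finite} fls)"
  using theta_neq_power_card[where ?'a = 'a] by (auto simp: carlitz_ell_def)

text \<open>With nodes x_i = \<theta>^(q^(k+i)), the additional factors are the Lagrange numerators
  \<theta> - x_i.\<close>

lemma carlitz_ell_add:
  "carlitz_ell (k + m) =
    carlitz_ell k * (\<Prod>i = 1..m. theta - theta ^ (CARD('a) ^ (k + i)) :: 'a::{field, finite} fls)"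
  by (induction m) (simp_all add: carlitz_ell_Suc mult.assoc)

text \<open>For the same nodes, with d = m, this is the Lagrange denominator, the product of the x_0
  - x_i.\<close>

lemma carlitz_ell_power_card:
  "(carlitz_ell m :: 'a::{field, finite} fls) ^ (CARD('a) ^ k) =
    (\<Prod>i = 1..m. theta ^ (CARD('a) ^ k) - theta ^ (CARD('a) ^ (k + i)))"
  unfolding carlitz_ell_def prod_power_distrib
  by (intro prod.cong) (simp_all add: diff_power_card_power_fls power_add mult.commute flip: power_mult)

text \<open>The exponent is split as q^(k+i) = q^k + (q-1)(q^k + ... + q^(k+i-1)); the second
  component of an index only counts the q - 1 copies.\<close>

lemma power_card_add_eq_prod:
  fixes y :: "'b::comm_monoid_mult"
  assumes "q > 0"
  shows "y ^ (q ^ (k + i)) = y ^ (q ^ k) * (\<Prod>(e, j)\<in>{k..<k + i} \<times> {..<q - 1}. y ^ (q ^ e))"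
proof (induction i)
  case (Suc i)
  have "y ^ (q ^ (k + Suc i)) = (y ^ (q ^ (k + i))) ^ (q - 1) * y ^ (q ^ (k + i))"
    using power_minus_mult[OF assms, of "y ^ (q ^ (k + i))"] by (simp add: mult.commute flip: power_mult)
  moreover have "(\<Prod>(e, j)\<in>{k..<k + Suc i} \<times> {..<q - 1}. y ^ (q ^ e)) =
      (y ^ (q ^ (k + i))) ^ (q - 1) * (\<Prod>(e, j)\<in>{k..<k + i} \<times> {..<q - 1}. y ^ (q ^ e))"
    by (simp add: prod.cartesian_product[symmetric] mult.commute)
  ultimately show ?case using Suc by (simp add: mult_ac)
qed simp

text \<open>For i = 0 every nonzero a contributes 1, and q^d - 1 = -1 in the field as d > 0. For i >
  0 the quotient is a product of i (q-1) values of a, fewer than d (q-1), so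
  \<open>sum_A_less_prod_eval_A_eq_0\<close> applies.\<close>

lemma sum_A_less_power_quotient:
  assumes "i < d"
  shows "(\<Sum>a\<in>A_less d. inverse (of_A a ^ (CARD('a) ^ k)) * of_A a ^ (CARD('a) ^ (k + i))) =
    (if i = 0 then - 1 else 0 :: 'a::{field, finite} fls)"
proof (cases "i = 0")
  case True
  have "(\<Sum>a\<in>A_less d. inverse (of_A a ^ (CARD('a) ^ k)) * of_A a ^ (CARD('a) ^ (k + i))) =
      (\<Sum>a\<in>A_less d - {0 :: 'a poly}. 1 :: 'a fls)"
    unfolding True by (rule sum.mono_neutral_cong_right) (use finite_A_less in \<open>auto simp: A_less_def\<close>)
  also have "\<dots> = of_nat (CARD('a) ^ d - 1)"
    unfolding sum_constant mult_1_right
    by (subst card_Diff_singleton, simp add: A_less_def, simp only: card_A_less)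
  also have "\<dots> = - 1"
    using assms of_nat_card_field[where ?'a = 'a] by (simp add: of_nat_diff fls_of_nat power_0_left)
  finally show ?thesis using True by simp
next
  case False
  define S where "S = {k..<k + i} \<times> {..<CARD('a) - 1}"
  have "inverse (of_A a ^ (CARD('a) ^ k)) * of_A a ^ (CARD('a) ^ (k + i)) =
      (\<Prod>s\<in>S. eval_A a (theta ^ (CARD('a) ^ fst s)))" for a :: "'a poly"
  proof (cases "a = 0")
    case True
    have "(k, 0) \<in> S" "finite S" using False card_field_gt_1[where ?'a = 'a] by (auto simp: S_def)
    hence "(\<Prod>s\<in>S. eval_A a (theta ^ (CARD('a) ^ fst s))) = 0"
      using True by (intro prod_zero) auto
    moreover have "of_A a ^ (CARD('a) ^ (k + i)) = 0"
      using True card_field_gt_1[where ?'a = 'a] by (simp only: power_eq_0_iff of_A_eq_0_iff) simp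
    ultimately show ?thesis by (simp only: mult_zero_right)
  next
    case False
    have "of_A a ^ (CARD('a) ^ (k + i)) =
        of_A a ^ (CARD('a) ^ k) * (\<Prod>(e, j)\<in>S. of_A a ^ (CARD('a) ^ e))"
      unfolding S_def by (rule power_card_add_eq_prod) simp
    thus ?thesis using False by (simp add: of_A_power_card_power[symmetric] case_prod_unfold)
  qed
  moreover have "card S < d * (CARD('a) - 1)" "finite S"
    using assms card_field_gt_1[where ?'a = 'a] by (simp_all add: S_def)
  ultimately show ?thesis
    using sum_A_less_prod_eval_A_eq_0[of S d "\<lambda>s. theta ^ (CARD('a) ^ fst s)"] False by simp
qed

text \<open>
  Lagrange interpolation in \<open>t\<close> of the polynomial \<open>\<Sum> a(t) / a(\<theta>) ^ (q ^ k)\<close> of degree at most \<open>d\<close>,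
  whose values at the \<open>d + 1\<close> points \<open>\<theta> ^ (q ^ (k + i))\<close> are known, evaluated at \<open>t = \<theta>\<close>.
\<close>
lemma sum_A_less_quotient:
  "(\<Sum>a\<in>A_less (Suc d). inverse (of_A a ^ (CARD('a) ^ k)) * of_A a) =
    - (carlitz_ell (k + d) / (carlitz_ell k * carlitz_ell d ^ (CARD('a) ^ k)) :: 'a::{field, finite} fls)"
proof -
  define x :: "nat \<Rightarrow> 'a fls" where "x i = theta ^ (CARD('a) ^ (k + i))" for i
  define G where "G = (\<Sum>a\<in>A_less (Suc d).
    Polynomial.smult (inverse (of_A a ^ (CARD('a) ^ k))) (map_poly fls_const (a :: 'a poly)))"
  \<comment> \<open>The negated Lagrange basis polynomial of the node x_0: its value is -1 there and
    0 at x_1, ..., x_d.\<close>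
  define H where "H = Polynomial.smult (- inverse (\<Prod>i = 1..d. x 0 - x i)) (\<Prod>i = 1..d. [:- x i, 1:])"
  have G: "poly G t = (\<Sum>a\<in>A_less (Suc d). inverse (of_A a ^ (CARD('a) ^ k)) * eval_A a t)" for t
    by (simp add: G_def poly_sum eval_A_def)
  have H: "poly H t = - (\<Prod>i = 1..d. t - x i) / (\<Prod>i = 1..d. x 0 - x i)" for t
    by (simp add: H_def poly_prod divide_inverse)
  have inj: "inj x"
    unfolding inj_def x_def theta_power_eq_iff using card_field_gt_1[where ?'a = 'a] by simp
  have nz: "(\<Prod>i = 1..d. x 0 - x i) \<noteq> 0" by (auto simp: inj_eq[OF inj])
  have "G = H"
  proof (rule poly_eqI_degree[of "x ` {..d}"])
    fix t assume "t \<in> x ` {..d}"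
    then obtain i where i: "i \<le> d" "t = x i" by blast
    have "poly G t = (if i = 0 then - 1 else 0)"
      unfolding G i(2) x_def using i(1) sum_A_less_power_quotient[of i "Suc d" k, where ?'a = 'a]
      by (simp add: of_A_power_card_power)
    also have "\<dots> = poly H t"
      using i nz by (auto simp: H intro!: bexI[of _ i])
    finally show "poly G t = poly H t" .
  next
    have card: "card (x ` {..d}) = Suc d"
      using inj by (simp add: card_image inj_on_subset)
    have "Polynomial.degree G \<le> d"
      unfolding G_def
      by (rule degree_sum_le[OF finite_A_less])
        (auto simp: A_less_def intro!: order.trans[OF degree_smult_le] order.trans[OF eq_imp_le[OF degree_map_poly]])
    thus "Polynomial.degree G < card (x ` {..d})" by (simp add: card)
    have "Polynomial.degree H \<le> Polynomial.degree (\<Prod>i = 1..d. [:- x i, 1:])"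
      unfolding H_def by (rule degree_smult_le)
    also have "\<dots> \<le> (\<Sum>i = 1..d. Polynomial.degree [:- x i, 1:])"
      by (rule order.trans[OF degree_prod_sum_le]) simp_all
    finally show "Polynomial.degree H < card (x ` {..d})" by (simp add: card)
  qed
  hence "poly G theta = poly H theta" by simp
  moreover have "(\<Prod>i = 1..d. theta - x i) = carlitz_ell (k + d) / carlitz_ell k"
    using carlitz_ell_nonzero[of k, where ?'a = 'a] by (simp add: carlitz_ell_add x_def)
  ultimately show ?thesis
    by (simp add: G H of_A_eq_eval_A carlitz_ell_power_card x_def)
qed

section \<open>From all polynomials of bounded degree to the monic ones\<close>

lemma A_less_eq_smult_image:
  "A_less d - {0} = (\<lambda>(c, a). Polynomial.smult c a) `
    ((UNIV - {0}) \<times> {a \<in> A_plus. Polynomial.degree a < d})"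
proof (intro equalityI subsetI)
  fix a :: "'a poly" assume a: "a \<in> A_less d - {0}"
  have "a = Polynomial.smult (Polynomial.lead_coeff a) (Polynomial.smult (inverse (Polynomial.lead_coeff a)) a)"
    using a by simp
  thus "a \<in> (\<lambda>(c, a). Polynomial.smult c a) ` ((UNIV - {0}) \<times> {a \<in> A_plus. Polynomial.degree a < d})"
    using a by (intro image_eqI[of _ _ "(Polynomial.lead_coeff a, Polynomial.smult (inverse (Polynomial.lead_coeff a)) a)"])
      (auto simp: A_less_def A_plus_def)
qed (auto simp: A_less_def A_plus_def)

lemma inj_on_smult_A_plus:
  "inj_on (\<lambda>(c, a). Polynomial.smult c a) ((UNIV - {0}) \<times> {a \<in> A_plus. Polynomial.degree a < d})"
proof -
  have smult_inj: "c = c' \<and> a = b"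
    if *: "c \<noteq> 0" "c' \<noteq> 0" "a \<in> A_plus" "b \<in> A_plus" "Polynomial.smult c a = Polynomial.smult c' b"
    for c c' :: 'a and a b
  proof -
    have "c = Polynomial.lead_coeff (Polynomial.smult c a)" using *(1,3) by (simp add: A_plus_def)
    also have "\<dots> = c'" unfolding *(5) using *(2,4) by (simp add: A_plus_def)
    finally have "c = c'" .
    moreover from this have "Polynomial.smult c (a - b) = 0" using * by (simp add: smult_diff_right)
    ultimately show ?thesis using * by simp
  qed
  show ?thesis
  proof (rule inj_onI)
    fix x y :: "'a \<times> 'a poly"
    assume "x \<in> (UNIV - {0}) \<times> {a \<in> A_plus. Polynomial.degree a < d}"
      "y \<in> (UNIV - {0}) \<times> {a \<in> A_plus. Polynomial.degree a < d}"
      "(case x of (c, a) \<Rightarrow> Polynomial.smult c a) = (case y of (c, a) \<Rightarrow> Polynomial.smult c a)"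
    thus "x = y"
      using smult_inj[of "fst x" "fst y" "snd x" "snd y"] by (simp add: mem_Times_iff case_prod_unfold prod_eq_iff)
  qed
qed

text \<open>The quotient a / a^(q^k) is unchanged when a is scaled by a nonzero constant, so the sum
  over all nonzero a is q - 1 = -1 times the sum over monic a. This sign cancels the one in
  \<open>sum_A_less_quotient\<close>.\<close>

lemma sum_power_sum_card_power_minus_1:
  "(\<Sum>e\<le>d. power_sum e (int (CARD('a) ^ k - 1))) =
    (carlitz_ell (k + d) / (carlitz_ell k * carlitz_ell d ^ (CARD('a) ^ k)) :: 'a::{field, finite} fls)"
proof -
  define M where "M = {a :: 'a poly. a \<in> A_plus \<and> Polynomial.degree a < Suc d}"
  define f where "f a = inverse (of_A a ^ (CARD('a) ^ k)) * of_A a" for a :: "'a poly"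
  have finM: "finite M" by (rule finite_subset[OF _ finite_degree_le[of d]]) (auto simp: M_def)
  have f_smult: "f (Polynomial.smult c a) = f a" if "c \<noteq> 0" for c a
    using that by (cases "a = 0") (simp_all add: f_def of_A_eq_eval_A eval_A_smult power_mult_distrib
      finite_field_power_card_power field_simps flip: fls_const_power)
  have f: "f a = of_A a powi (- int (CARD('a) ^ k - 1))" if "a \<in> A_plus" for a
  proof -
    have "of_A a \<noteq> 0" using that by (auto simp: A_plus_def)
    moreover define m where "m = CARD('a) ^ k - 1"
    have "of_A a ^ (CARD('a) ^ k) = of_A a ^ m * of_A a"
      unfolding m_def by (rule power_minus_mult[symmetric]) simp
    ultimately show ?thesis unfolding m_def[symmetric] by (simp add: f_def power_int_minus)
  qed
  have "(\<Sum>a\<in>A_less (Suc d). f a) = (\<Sum>a\<in>A_less (Suc d) - {0}. f a)"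
    by (rule sum.mono_neutral_right) (auto simp: finite_A_less f_def)
  also have "\<dots> = (\<Sum>(c, a)\<in>(UNIV - {0}) \<times> M. f (Polynomial.smult c a))"
    unfolding A_less_eq_smult_image M_def
    by (subst sum.reindex[OF inj_on_smult_A_plus]) (simp add: case_prod_unfold)
  also have "\<dots> = (\<Sum>(c, a)\<in>(UNIV - {0 :: 'a}) \<times> M. f a)"
    by (rule sum.cong) (simp_all add: f_smult case_prod_unfold mem_Times_iff)
  also have "\<dots> = of_nat (CARD('a) - 1) * (\<Sum>a\<in>M. f a)"
    by (simp add: sum.cartesian_product[symmetric] card_Diff_singleton)
  also have "\<dots> = - (\<Sum>a\<in>M. f a)"
    using of_nat_card_field[where ?'a = 'a] by (simp add: of_nat_diff fls_of_nat Suc_leI)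
  finally have "(\<Sum>a\<in>M. f a) =
      carlitz_ell (k + d) / (carlitz_ell k * carlitz_ell d ^ (CARD('a) ^ k))"
    using sum_A_less_quotient[where d = d and k = k and ?'a = 'a] by (simp add: f_def)
  also have "(\<Sum>a\<in>M. f a) = (\<Sum>e\<le>d. \<Sum>a | a \<in> M \<and> Polynomial.degree a = e. f a)"
    by (rule sum.group[symmetric]) (use finM in \<open>auto simp: M_def\<close>)
  also have "\<dots> = (\<Sum>e\<le>d. power_sum e (int (CARD('a) ^ k - 1)))"
    unfolding power_sum_def by (intro sum.cong refl) (auto simp: M_def f)
  finally show ?thesis .
qed

lemma power_sum_card_power_minus_1:
  assumes "k > 0"
  shows "power_sum d (int (CARD('a) ^ k - 1)) =
    (carlitz_ell (k + d - 1) / (carlitz_ell (k - 1) * carlitz_ell d ^ (CARD('a) ^ k)) :: 'a::{field, finite} fls)"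
proof -
  obtain m where k: "k = Suc m" using assms by (cases k) auto
  define u where "u = (\<lambda>d. carlitz_ell (k + d) / (carlitz_ell k * carlitz_ell d ^ (CARD('a) ^ k)) :: 'a fls)"
  have nz: "carlitz_ell i \<noteq> (0 :: 'a fls)" for i by (rule carlitz_ell_nonzero)
  show ?thesis
  proof (cases d)
    case 0
    thus ?thesis using sum_power_sum_card_power_minus_1[of k 0, where ?'a = 'a] nz k by simp
  next
    case (Suc e)
    define b :: "nat \<Rightarrow> 'a fls" where "b i = theta - theta ^ (CARD('a) ^ i)" for i
    have ell: "carlitz_ell (Suc i) = carlitz_ell i * b (Suc i)" for i
      by (simp add: carlitz_ell_Suc b_def)
    have bnz: "b (Suc i) \<noteq> 0" for i using theta_neq_power_card[of "Suc i", where ?'a = 'a] by (simp add: b_def)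
    \<comment> \<open>Both terms contain \<theta>^(q^(k+e+1)), which cancels; so the difference of
      consecutive partial sums collapses into a single quotient.\<close>
    have b: "b (Suc (k + e)) - b (Suc e) ^ (CARD('a) ^ k) = b k"
      by (simp add: b_def diff_power_card_power_fls power_add flip: power_mult) (simp add: mult_ac)
    have "power_sum d (int (CARD('a) ^ k - 1)) = u d - u e"
      unfolding u_def sum_power_sum_card_power_minus_1[symmetric] Suc by simp
    also have "\<dots> = carlitz_ell (k + e) * (b (Suc (k + e)) - b (Suc e) ^ (CARD('a) ^ k)) /
        (carlitz_ell k * carlitz_ell d ^ (CARD('a) ^ k))"
      using nz bnz by (simp add: u_def Suc ell power_mult_distrib field_simps)
    also have "\<dots> = carlitz_ell (k + e) / (carlitz_ell m * carlitz_ell d ^ (CARD('a) ^ k))"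
      unfolding b using nz bnz by (simp add: k ell field_simps)
    finally show ?thesis by (simp add: k Suc)
  qed
qed

section \<open>Frobenius twists and the product relation of power sums\<close>

lemma power_sum_mult_card_power:
  "power_sum d (int (s * CARD('a) ^ n)) = (power_sum d (int s) :: 'a::{field, finite} fls) ^ (CARD('a) ^ n)"
  unfolding power_sum_def sum_power_card_power_fls
  by (intro sum.cong) (simp_all add: power_int_minus power_int_def power_mult power_inverse nat_mult_distrib flip: of_nat_mult of_nat_power)

text \<open>The first factor is \<open>carlitz_ell d\<close> to the power q^n - q^(n+1); its
  numerator cancels the corresponding denominator in the closed form of the partial sum.\<close>

lemma power_sum_mult_sum_power_sum:
  "power_sum d (int ((CARD('a) - 1) * CARD('a) ^ n)) * (\<Sum>e\<le>d. power_sum e (int (CARD('a) ^ n - 1))) =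
    (power_sum d (int (CARD('a) ^ Suc n - 1)) :: 'a::{field, finite} fls)"
proof -
  have nz: "carlitz_ell i \<noteq> (0 :: 'a fls)" for i by (rule carlitz_ell_nonzero)
  have "power_sum d (int (CARD('a) - 1)) = (carlitz_ell d / carlitz_ell d ^ CARD('a) :: 'a fls)"
    using power_sum_card_power_minus_1[of 1 d, where ?'a = 'a] by simp
  hence *: "power_sum d (int (CARD('a) - 1)) ^ (CARD('a) ^ n) =
      (carlitz_ell d ^ (CARD('a) ^ n) / carlitz_ell d ^ (CARD('a) ^ Suc n) :: 'a fls)"
    by (simp only: power_divide flip: power_mult) (simp add: mult.commute)
  show ?thesis
    unfolding * power_sum_mult_card_power sum_power_sum_card_power_minus_1
      power_sum_card_power_minus_1[of "Suc n" d, OF zero_less_Suc, where ?'a = 'a]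
    using nz by (simp add: field_simps)
qed


subsection \<open>Limits of Laurent series\<close>

lemma dist_fls_less_imp_val_ge:
  assumes "dist f g < inverse (2 ^ N)"
  shows "val_ge (f - g) (int N)"
proof (cases "f = g")
  case False
  have "fls_subdegree (f - g) \<ge> 0"
  proof (rule ccontr)
    assume *: "\<not> ?thesis"
    hence "(1 :: real) \<le> dist f g" using False by (simp add: dist_fls_def)
    moreover have "inverse (2 ^ N) \<le> (1 :: real)" by (simp add: inverse_le_1_iff)
    ultimately show False using assms by linarith
  qed
  hence "(2 :: real) ^ N < 2 ^ nat (fls_subdegree (f - g))"
    using assms False by (simp add: dist_fls_def)
  hence "N < nat (fls_subdegree (f - g))" by simp
  hence "int N \<le> fls_subdegree (f - g)" by linarith
  thus ?thesis by (simp add: val_ge_alt)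
qed (simp add: val_ge_def)

text \<open>Reduces convergence to valuations, from which the limit laws for differences and
  products follow.\<close>

lemma tendsto_fls_iff:
  fixes f :: "'i \<Rightarrow> 'a::{field, finite} fls"
  shows "(f \<longlongrightarrow> l) F \<longleftrightarrow> (\<forall>N. \<forall>\<^sub>F x in F. val_ge (f x - l) N)"
proof
  assume lim: "(f \<longlongrightarrow> l) F"
  show "\<forall>N. \<forall>\<^sub>F x in F. val_ge (f x - l) N"
  proof
    fix N :: int
    have "\<forall>\<^sub>F x in F. dist (f x) l < inverse (2 ^ nat N)"
      using lim unfolding tendsto_iff by simp
    thus "\<forall>\<^sub>F x in F. val_ge (f x - l) N"
      by eventually_elim (rule val_ge_mono[OF dist_fls_less_imp_val_ge], auto)
  qed
next
  assume val: "\<forall>N. \<forall>\<^sub>F x in F. val_ge (f x - l) N"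
  show "(f \<longlongrightarrow> l) F"
    unfolding tendsto_iff
  proof (intro allI impI)
    fix e :: real assume "e > 0"
    then obtain N where N: "inverse (2 ^ N) < e"
      using real_arch_pow_inv[of e "1/2"] by (auto simp: power_one_over inverse_eq_divide)
    from val have "\<forall>\<^sub>F x in F. val_ge (f x - l) (int N)" by blast
    thus "\<forall>\<^sub>F x in F. dist (f x) l < e"
      by eventually_elim (use val_ge_dist N le_less_trans in blast)
  qed
qed

lemma val_ge_add: "val_ge f n \<Longrightarrow> val_ge g n \<Longrightarrow> val_ge (f + g) n"
  by (simp add: val_ge_def)

lemma val_ge_subdegree: "val_ge f (fls_subdegree f)"
  by (simp add: val_ge_alt)

lemma tendsto_diff_fls:
  fixes f g :: "'i \<Rightarrow> 'a::{field, finite} fls"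
  assumes "(f \<longlongrightarrow> a) F" "(g \<longlongrightarrow> b) F"
  shows "((\<lambda>x. f x - g x) \<longlongrightarrow> a - b) F"
  unfolding tendsto_fls_iff
proof
  fix N
  have "\<forall>\<^sub>F x in F. val_ge (f x - a) N" "\<forall>\<^sub>F x in F. val_ge (g x - b) N"
    using assms unfolding tendsto_fls_iff by blast+
  thus "\<forall>\<^sub>F x in F. val_ge (f x - g x - (a - b)) N"
    by eventually_elim (simp add: val_ge_def)
qed

lemma tendsto_mult_fls:
  fixes f g :: "'i \<Rightarrow> 'a::{field, finite} fls"
  assumes "(f \<longlongrightarrow> a) F" "(g \<longlongrightarrow> b) F"
  shows "((\<lambda>x. f x * g x) \<longlongrightarrow> a * b) F"
  unfolding tendsto_fls_iff
proof
  fix N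
  \<comment> \<open>The bound |N| gives 2M \<ge> N for the product of both errors; the other two
    bounds make up for the valuations of \<open>a\<close> and \<open>b\<close> in the mixed
    terms.\<close>
  define M where "M = max \<bar>N\<bar> (max (N - fls_subdegree a) (N - fls_subdegree b))"
  have M: "\<bar>N\<bar> \<le> M" "N - fls_subdegree a \<le> M" "N - fls_subdegree b \<le> M" by (simp_all add: M_def)
  have "\<forall>\<^sub>F x in F. val_ge (f x - a) M" "\<forall>\<^sub>F x in F. val_ge (g x - b) M"
    using assms unfolding tendsto_fls_iff by blast+
  thus "\<forall>\<^sub>F x in F. val_ge (f x * g x - a * b) N"
  proof eventually_elim
    case (elim x)
    have "val_ge ((f x - a) * (g x - b)) N"
      by (rule val_ge_mono[OF val_ge_mult[OF elim]]) (use M in linarith)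
    moreover have "val_ge (a * (g x - b)) N"
      by (rule val_ge_mono[OF val_ge_mult[OF val_ge_subdegree elim(2)]]) (use M in linarith)
    moreover have "val_ge ((f x - a) * b) N"
      by (rule val_ge_mono[OF val_ge_mult[OF elim(1) val_ge_subdegree]]) (use M in linarith)
    moreover have "f x * g x - a * b = (f x - a) * (g x - b) + a * (g x - b) + (f x - a) * b"
      by (simp add: algebra_simps)
    ultimately show ?case by (simp add: val_ge_add)
  qed
qed

lemma tendsto_power_fls:
  fixes f :: "'i \<Rightarrow> 'a::{field, finite} fls"
  assumes "(f \<longlongrightarrow> a) F"
  shows "((\<lambda>x. f x ^ n) \<longlongrightarrow> a ^ n) F"
  by (induction n) (simp_all add: tendsto_mult_fls assms)

text \<open>The increments have valuations tending to infinity, hence are summable, and their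
  partial sums telescope.\<close>

lemma convergent_fls:
  fixes f :: "nat \<Rightarrow> 'a::{field, finite} fls"
  assumes "\<And>n. val_ge (f (Suc n) - f n) (int n)"
  shows "\<exists>l. f \<longlonglongrightarrow> l"
proof -
  define u where "u n = f (Suc n) - f n" for n
  have "finite {n \<in> UNIV. \<not> val_ge (u n) N}" for N
  proof (rule finite_subset)
    show "{n \<in> UNIV. \<not> val_ge (u n) N} \<subseteq> {..nat N}"
    proof safe
      fix n assume "\<not> val_ge (u n) N"
      hence "int n < N" using val_ge_mono[OF assms[of n], of N] by (metis not_le u_def)
      thus "n \<le> nat N" by linarith
    qed
  qed simp
  hence "u summable_on UNIV" by (rule fls_summable_onI(1))
  then obtain s where "(u has_sum s) UNIV" by (auto simp: summable_on_def)
  hence "(\<lambda>n. \<Sum>i<n. u i) \<longlonglongrightarrow> s" using has_sum_imp_sums sums_def by blast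
  moreover have "(\<Sum>i<n. u i) = f n - f 0" for n by (simp add: u_def sum_lessThan_telescope)
  ultimately have "(\<lambda>n. f n - f 0) \<longlonglongrightarrow> s" by simp
  hence "(\<lambda>n. f n - f 0 - (- f 0)) \<longlonglongrightarrow> s - (- f 0)" by (intro tendsto_diff_fls tendsto_const)
  thus ?thesis by auto
qed


subsection \<open>Truncated multizeta values\<close>

text \<open>Recursion on the largest index: bounding the next index by \<open>d\<close> encodes the
  strict decrease. The finite sums allow identities to be proved before passing to the
  limit.\<close>

fun mzeta_below :: "nat \<Rightarrow> nat list \<Rightarrow> 'a::{field, finite} fls" where
  "mzeta_below D [] = 1"
| "mzeta_below D (s # ss) = (\<Sum>d<D. power_sum d (int s) * mzeta_below d ss)"

lemma mzeta_below_eq_sum: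
  "(mzeta_below D ss :: 'a::{field, finite} fls) =
    (\<Sum>ds | length ds = length ss \<and> sorted_wrt (>) ds \<and> set ds \<subseteq> {..<D}.
      \<Prod>i<length ss. power_sum (ds ! i) (int (ss ! i)))"
proof (induction ss arbitrary: D)
  case Nil
  have "{ds :: nat list. length ds = length ([] :: nat list) \<and> sorted_wrt (>) ds \<and> set ds \<subseteq> {..<D}} = {[]}"
    by auto
  thus ?case by simp
next
  case (Cons s ss)
  define J where "J D = {ds :: nat list. length ds = length ss \<and> sorted_wrt (>) ds \<and> set ds \<subseteq> {..<D}}" for D
  have fin: "finite (J D)" for D
    by (rule finite_subset[OF _ finite_lists_length_eq[of "{..<D}" "length ss"]]) (auto simp: J_def)
  have "{ds :: nat list. length ds = length (s # ss) \<and> sorted_wrt (>) ds \<and> set ds \<subseteq> {..<D}} =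
      (\<lambda>(d, ds). d # ds) ` (SIGMA d:{..<D}. J d)" (is "?L = ?R")
  proof (intro equalityI subsetI)
    fix ds assume "ds \<in> ?L"
    thus "ds \<in> ?R" by (cases ds) (auto simp: J_def)
  qed (fastforce simp: J_def)
  hence "(\<Sum>ds | length ds = length (s # ss) \<and> sorted_wrt (>) ds \<and> set ds \<subseteq> {..<D}.
      \<Prod>i<length (s # ss). power_sum (ds ! i) (int ((s # ss) ! i)) :: 'a fls) =
      (\<Sum>(d, ds)\<in>(SIGMA d:{..<D}. J d). \<Prod>i<length (s # ss). power_sum ((d # ds) ! i) (int ((s # ss) ! i)))"
    by (simp only:) (subst sum.reindex, auto simp: inj_on_def case_prod_unfold)
  also have "\<dots> = (\<Sum>d<D. \<Sum>ds\<in>J d. \<Prod>i<length (s # ss). power_sum ((d # ds) ! i) (int ((s # ss) ! i)))"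
    by (rule sum.Sigma[symmetric]) (auto simp: fin)
  also have "\<dots> = (\<Sum>d<D. power_sum d (int s) * (\<Sum>ds\<in>J d. \<Prod>i<length ss. power_sum (ds ! i) (int (ss ! i))))"
    by (simp only: length_Cons prod.lessThan_Suc_shift) (simp add: sum_distrib_left)
  finally show ?case by (simp add: Cons.IH J_def)
qed

text \<open>The index lists with entries below D eventually contain any given finite set of index
  lists, so the unordered sum is also the limit along D.\<close>

lemma mzeta_below_tendsto:
  assumes "\<And>s. s \<in> set ss \<Longrightarrow> s > 0"
  shows "(\<lambda>D. mzeta_below D ss) \<longlonglongrightarrow> (mzeta ss :: 'a::{field, finite} fls)"
proof -
  define I where "I = {ds :: nat list. length ds = length ss \<and> sorted_wrt (>) ds}"
  define J where "J D = {ds :: nat list. length ds = length ss \<and> sorted_wrt (>) ds \<and> set ds \<subseteq> {..<D}}" for D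
  define f where "f ds = (\<Prod>i<length ss. power_sum (ds ! i) (int (ss ! i)) :: 'a fls)" for ds
  have "(f has_sum mzeta ss) I"
    unfolding mzeta_def I_def f_def by (intro has_sum_infsum mzeta_summable assms)
  hence "(sum f \<longlongrightarrow> mzeta ss) (finite_subsets_at_top I)" by (simp add: has_sum_def)
  moreover have "filterlim J (finite_subsets_at_top I) sequentially"
    unfolding filterlim_finite_subsets_at_top
  proof (intro allI impI)
    fix B assume B: "finite B \<and> B \<subseteq> I"
    \<comment> \<open>The inserted 0 keeps the maximum meaningful when no index occurs in
      \<open>B\<close>.\<close>
    define N where "N = Suc (Max (insert 0 (\<Union>ds\<in>B. set ds)))"
    have "finite (J D) \<and> B \<subseteq> J D \<and> J D \<subseteq> I" if "D \<ge> N" for D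
    proof (intro conjI)
      show "finite (J D)"
        by (rule finite_subset[OF _ finite_lists_length_eq[of "{..<D}" "length ss"]]) (auto simp: J_def)
      show "J D \<subseteq> I" by (auto simp: J_def I_def)
      show "B \<subseteq> J D"
      proof
        fix ds assume ds: "ds \<in> B"
        have "d < D" if "d \<in> set ds" for d
        proof -
          have "d \<le> Max (insert 0 (\<Union>ds\<in>B. set ds))" using that ds B by (intro Max_ge) auto
          thus ?thesis using \<open>D \<ge> N\<close> by (simp add: N_def)
        qed
        thus "ds \<in> J D" using ds B by (auto simp: J_def I_def)
      qed
    qed
    thus "\<forall>\<^sub>F D in sequentially. finite (J D) \<and> B \<subseteq> J D \<and> J D \<subseteq> I"
      unfolding eventually_sequentially by blast
  qed
  ultimately have "((\<lambda>D. sum f (J D)) \<longlongrightarrow> mzeta ss) sequentially" by (rule filterlim_compose)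
  thus ?thesis unfolding mzeta_below_eq_sum f_def J_def .
qed

section \<open>Frobenius twists and the recursion for multizeta values\<close>

lemma mzeta_below_map_mult_card_power:
  "mzeta_below D (map (\<lambda>s. s * CARD('a) ^ n) ss) = (mzeta_below D ss :: 'a::{field, finite} fls) ^ (CARD('a) ^ n)"
  by (induction ss arbitrary: D)
    (simp_all add: sum_power_card_power_fls power_mult_distrib power_sum_mult_card_power del: of_nat_mult of_nat_power)

lemma mzeta_map_mult_card_power:
  assumes "\<And>s. s \<in> set ss \<Longrightarrow> s > 0"
  shows "mzeta (map (\<lambda>s. s * CARD('a) ^ n) ss) = (mzeta ss :: 'a::{field, finite} fls) ^ (CARD('a) ^ n)"
proof (rule LIMSEQ_unique)
  show "(\<lambda>D. mzeta_below D (map (\<lambda>s. s * CARD('a) ^ n) ss)) \<longlonglongrightarrow> (mzeta (map (\<lambda>s. s * CARD('a) ^ n) ss) :: 'a fls)"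
    by (rule mzeta_below_tendsto) (use assms in auto)
  show "(\<lambda>D. mzeta_below D (map (\<lambda>s. s * CARD('a) ^ n) ss)) \<longlonglongrightarrow> (mzeta ss :: 'a fls) ^ (CARD('a) ^ n)"
    unfolding mzeta_below_map_mult_card_power by (intro tendsto_power_fls mzeta_below_tendsto assms)
qed

text \<open>The pairs (e, d) are split according to e > d or e \<le> d.\<close>

lemma sum_mult_sum_lessThan:
  fixes f g :: "nat \<Rightarrow> 'b::comm_ring"
  shows "(\<Sum>e<D. f e) * (\<Sum>d<D. g d) = (\<Sum>e<D. f e * (\<Sum>d<e. g d)) + (\<Sum>d<D. g d * (\<Sum>e\<le>d. f e))"
  by (induction D) (simp_all add: algebra_simps lessThan_Suc_atMost[symmetric])

text \<open>In the truncated product, the pairs with e > d give the value of greater depth; for e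
  \<le> d the sum over e is absorbed into the power sum at d by
  \<open>power_sum_mult_sum_power_sum\<close>.\<close>

lemma zeta_mult_mzeta:
  fixes n :: nat and ss :: "nat list"
  assumes "n > 0" "\<And>s. s \<in> set ss \<Longrightarrow> s > 0"
  defines "q \<equiv> CARD('a::{field, finite})"
  shows "(zeta (q ^ n - 1) :: 'a fls) * mzeta ((q - 1) * q ^ n # ss) =
    mzeta ((q ^ n - 1) # (q - 1) * q ^ n # ss) + mzeta ((q ^ Suc n - 1) # ss)"
proof -
  have q: "q > 1" using card_field_gt_1 by (simp add: q_def)
  have pos: "q ^ n - 1 > 0" "q ^ Suc n - 1 > 0" "(q - 1) * q ^ n > 0"
    using q one_less_power[OF q, of n] one_less_power[OF q, of "Suc n"] assms(1) by simp_all
  have below: "mzeta_below D [q ^ n - 1] * mzeta_below D ((q - 1) * q ^ n # ss) -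
      mzeta_below D ((q ^ n - 1) # (q - 1) * q ^ n # ss) = (mzeta_below D ((q ^ Suc n - 1) # ss) :: 'a fls)" for D
  proof -
    have "power_sum d (int ((q - 1) * q ^ n)) * mzeta_below d ss * (\<Sum>e\<le>d. power_sum e (int (q ^ n - 1))) =
        power_sum d (int (q ^ Suc n - 1)) * (mzeta_below d ss :: 'a fls)" for d
      unfolding q_def power_sum_mult_sum_power_sum[symmetric] by (simp only: mult_ac)
    thus ?thesis
      by (simp only: mzeta_below.simps mult_1_right sum_mult_sum_lessThan) simp
  qed
  have "(\<lambda>D. mzeta_below D ((q ^ Suc n - 1) # ss) :: 'a fls) \<longlonglongrightarrow> 
      mzeta [q ^ n - 1] * mzeta ((q - 1) * q ^ n # ss) - mzeta ((q ^ n - 1) # (q - 1) * q ^ n # ss)"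
    unfolding below[symmetric]
    by (intro tendsto_diff_fls tendsto_mult_fls mzeta_below_tendsto) (use pos assms(2) in auto)
  moreover have "(\<lambda>D. mzeta_below D ((q ^ Suc n - 1) # ss) :: 'a fls) \<longlonglongrightarrow> mzeta ((q ^ Suc n - 1) # ss)"
    by (intro mzeta_below_tendsto) (use pos assms(2) in auto)
  ultimately have "mzeta ((q ^ Suc n - 1) # ss) = 
      mzeta [q ^ n - 1] * mzeta ((q - 1) * q ^ n # ss) - (mzeta ((q ^ n - 1) # (q - 1) * q ^ n # ss) :: 'a fls)"
    using LIMSEQ_unique by blast
  thus ?thesis unfolding mzeta_depth_one[OF pos(1)] by simp
qed


subsection \<open>Zeta values and the closed form\<close>

lemma zeta_card_power_minus_1_tendsto:
  assumes "k > 0"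
  shows "(\<lambda>d. carlitz_ell (k + d) / carlitz_ell d ^ (CARD('a) ^ k)) \<longlonglongrightarrow>
    (carlitz_ell k * zeta (CARD('a) ^ k - 1) :: 'a::{field, finite} fls)"
proof -
  have pos: "CARD('a) ^ k - 1 > 0"
    using one_less_power[OF card_field_gt_1[where ?'a = 'a] assms] by simp
  \<comment> \<open>The shift is due to \<open>mzeta_below\<close> having a strict bound, whereas
    the closed form sums up to d inclusively.\<close>
  have "(\<lambda>d. mzeta_below (Suc d) [CARD('a) ^ k - 1]) \<longlonglongrightarrow> (zeta (CARD('a) ^ k - 1) :: 'a fls)"
    unfolding mzeta_depth_one[OF pos, symmetric]
    by (rule LIMSEQ_Suc, rule mzeta_below_tendsto) (use pos in simp)
  hence "(\<lambda>d. carlitz_ell k * mzeta_below (Suc d) [CARD('a) ^ k - 1]) \<longlonglongrightarrow>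
      (carlitz_ell k * zeta (CARD('a) ^ k - 1) :: 'a fls)"
    by (intro tendsto_mult_fls tendsto_const)
  moreover have "carlitz_ell k * mzeta_below (Suc d) [CARD('a) ^ k - 1] =
      (carlitz_ell (k + d) / carlitz_ell d ^ (CARD('a) ^ k) :: 'a fls)" for d
    using carlitz_ell_nonzero[of k, where ?'a = 'a]
    by (simp only: mzeta_below.simps mult_1_right lessThan_Suc_atMost sum_power_sum_card_power_minus_1) simp
  ultimately show ?thesis by simp
qed

lemma carlitz_ell_mult_zeta_add:
  fixes n m :: nat
  assumes "n > 0" "m > 0"
  defines "w \<equiv> \<lambda>k. carlitz_ell k * zeta (CARD('a) ^ k - 1) :: 'a::{field, finite} fls"
  shows "w (n + m) = w n * w m ^ (CARD('a) ^ n)"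
proof (rule LIMSEQ_unique)
  define v where "v = (\<lambda>k d. carlitz_ell (k + d) / carlitz_ell d ^ (CARD('a) ^ k) :: 'a fls)"
  have lim: "v k \<longlonglongrightarrow> w k" if "k > 0" for k
    using zeta_card_power_minus_1_tendsto[OF that] by (simp add: v_def w_def)
  show "v (n + m) \<longlonglongrightarrow> w (n + m)" using assms by (intro lim) simp
  \<comment> \<open>After the shift by m, the denominator of the first factor cancels the numerator
    of the second for every d.\<close>
  have "(\<lambda>d. v n (d + m) * v m d ^ (CARD('a) ^ n)) \<longlonglongrightarrow> w n * w m ^ (CARD('a) ^ n)"
    using assms by (intro tendsto_mult_fls tendsto_power_fls LIMSEQ_ignore_initial_segment lim)
  moreover have "v n (d + m) * v m d ^ (CARD('a) ^ n) = v (n + m) d" for d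
    using carlitz_ell_nonzero[of "d + m", where ?'a = 'a]
    by (simp add: v_def power_divide power_add add_ac mult.commute flip: power_mult)
  ultimately show "v (n + m) \<longlonglongrightarrow> w n * w m ^ (CARD('a) ^ n)" by simp
qed

lemma carlitz_ell_eq_carlitz_L: "carlitz_ell k = (- 1) ^ k * carlitz_L k"
proof -
  have "carlitz_ell k = (\<Prod>i = 1..k. - 1 * bracket i :: 'a fls)"
    by (simp add: carlitz_ell_def bracket_def)
  thus ?thesis unfolding prod.distrib carlitz_L_def by simp
qed

lemma bracket_nonzero: "k > 0 \<Longrightarrow> bracket k \<noteq> (0 :: 'a::{field, finite} fls)"
  using theta_neq_power_card[of k, where ?'a = 'a] by (simp add: bracket_def)

lemma carlitz_L_nonzero: "carlitz_L k \<noteq> (0 :: 'a::{field, finite} fls)"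
  unfolding carlitz_L_def by (simp add: bracket_nonzero)

lemma carlitz_L_Suc: "carlitz_L (Suc k) = carlitz_L k * bracket (Suc k)"
  by (simp add: carlitz_L_def)

lemma carlitz_L_add: "carlitz_L (n + m) = carlitz_L n * (\<Prod>j = n + 1..<n + Suc m. bracket j)"
  by (induction m) (simp_all add: carlitz_L_Suc mult.assoc)

lemma carlitz_L_mult_zeta_add:
  assumes "n > 0" "m > 0"
  shows "carlitz_L (n + m) * zeta (CARD('a) ^ (n + m) - 1) =
    (carlitz_L n * zeta (CARD('a) ^ n - 1) *
      (carlitz_L m * zeta (CARD('a) ^ m - 1)) ^ (CARD('a) ^ n) :: 'a::{field, finite} fls)"
proof -
  define z where "z k = (zeta (CARD('a) ^ k - 1) :: 'a fls)" for k
  \<comment> \<open>The sign survives the Frobenius power, as (-1)^(q^n) = -1 in every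
    characteristic.\<close>
  have "((- 1 :: 'a fls) ^ m) ^ (CARD('a) ^ n) = ((- 1) ^ (CARD('a) ^ n)) ^ m"
    by (simp add: mult.commute flip: power_mult)
  also have "\<dots> = (- 1) ^ m" using minus_power_card_power_fls[of "1 :: 'a fls" n] by simp
  finally have "(- 1) ^ (n + m) * (carlitz_L (n + m) * z (n + m)) =
      (- 1) ^ (n + m) * (carlitz_L n * z n * (carlitz_L m * z m) ^ (CARD('a) ^ n))"
    using carlitz_ell_mult_zeta_add[OF assms, where ?'a = 'a, folded z_def]
    by (simp add: carlitz_ell_eq_carlitz_L power_mult_distrib power_add mult_ac)
  thus ?thesis by (simp add: z_def)
qed

text \<open>The entries from index n on are q^n times those from index 0, so the second factor in
  \<open>zeta_mult_mzeta\<close> is a q^n-th power.\<close>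

lemma zeta_mult_mzeta_powers:
  fixes n m :: nat
  assumes "n > 0"
  defines "q \<equiv> CARD('a::{field, finite})"
  defines "t \<equiv> \<lambda>i. (q - 1) * q ^ i"
  shows "(mzeta ((q ^ n - 1) # map t [n..<n + Suc m]) :: 'a fls) =
    zeta (q ^ n - 1) * mzeta (map t [0..<Suc m]) ^ (q ^ n) -
    mzeta ((q ^ (n + 1) - 1) # map t [n + 1..<n + Suc m])"
proof -
  have pos: "t i > 0" for i using card_field_gt_1[where ?'a = 'a] by (simp add: t_def q_def)
  have "map t [n..<n + Suc m] = map (\<lambda>s. s * q ^ n) (map t [0..<Suc m])"
  proof -
    have "[n..<n + Suc m] = map (\<lambda>i. i + n) [0..<Suc m]"
      by (simp only: map_add_upt add.commute)
    thus ?thesis by (simp only: map_map) (simp add: t_def power_add)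
  qed
  hence "(mzeta (map t [n..<n + Suc m]) :: 'a fls) = mzeta (map t [0..<Suc m]) ^ (q ^ n)"
    using mzeta_map_mult_card_power[of "map t [0..<Suc m]" n, where ?'a = 'a] pos by (auto simp: q_def)
  moreover have upt: "map t [n..<n + Suc m] = t n # map t [n + 1..<n + Suc m]" by (simp add: upt_conv_Cons del: upt_Suc)
  moreover have "(zeta (q ^ n - 1) :: 'a fls) * mzeta (t n # map t [n + 1..<n + Suc m]) =
      mzeta ((q ^ n - 1) # t n # map t [n + 1..<n + Suc m]) +
      mzeta ((q ^ Suc n - 1) # map t [n + 1..<n + Suc m])"
    unfolding t_def q_def by (rule zeta_mult_mzeta[OF assms(1)]) (use pos in \<open>auto simp: t_def q_def\<close>)
  ultimately show ?thesis by (simp only: upt Suc_eq_plus1 eq_diff_eq)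
qed

text \<open>Here m is the depth minus one. The induction needs n arbitrary: the recursion leads to a
  shorter value at n + 1 and to one with first entry q - 1 = q^1 - 1, which is the case n =
  1.\<close>

lemma mzeta_powers_eq:
  fixes n m :: nat
  assumes "n > 0"
  defines "q \<equiv> CARD('a::{field, finite})"
  defines "t \<equiv> \<lambda>i. (q - 1) * q ^ i"
  shows "(mzeta ((q ^ n - 1) # map t [n..<n + m]) :: 'a fls) =
    (\<Prod>j = n..<n + m. bracket j) / (\<Prod>k = 1..m. bracket k ^ (q ^ (n + m - k))) * zeta (q ^ (n + m) - 1)"
  using assms(1)
proof (induction m arbitrary: n)
  case 0
  thus ?case using one_less_power[OF card_field_gt_1[where ?'a = 'a] 0] by (simp add: mzeta_depth_one q_def)
next
  case (Suc m)
  define z where "z k = (zeta (q ^ k - 1) :: 'a fls)" for k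
  define P where "P = (\<Prod>j = 1..m. bracket j :: 'a fls)"
  define Q where "Q = (\<Prod>k = 1..m. bracket k ^ (q ^ (n + Suc m - k)) :: 'a fls)"
  define R where "R = (\<Prod>j = n + 1..<n + Suc m. bracket j :: 'a fls)"
  define B where "B = (bracket (Suc m) :: 'a fls) ^ (q ^ n)"
  have nz: "Q \<noteq> 0" "B \<noteq> 0" by (auto simp: Q_def B_def bracket_nonzero)
  have "(mzeta (map t [0..<Suc m]) :: 'a fls) = mzeta ((q ^ 1 - 1) # map t [1..<1 + m])"
    by (subst upt_conv_Cons) (simp_all add: t_def)
  also have "\<dots> = P / (\<Prod>k = 1..m. bracket k ^ (q ^ (1 + m - k))) * z (1 + m)"
    unfolding P_def z_def by (subst Suc.IH) (simp_all add: atLeastLessThanSuc_atLeastAtMost)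
  also have "\<dots> ^ (q ^ n) = P ^ (q ^ n) / Q * z (1 + m) ^ (q ^ n)"
  proof -
    have "(bracket k ^ (q ^ (1 + m - k))) ^ (q ^ n) = (bracket k ^ (q ^ (n + Suc m - k)) :: 'a fls)"
      if "k \<in> {1..m}" for k
    proof -
      have "n + Suc m - k = (1 + m - k) + n" using that by auto
      thus ?thesis by (simp only: power_add power_mult)
    qed
    thus ?thesis by (simp add: Q_def power_mult_distrib power_divide prod_power_distrib)
  qed
  finally have Y: "(mzeta (map t [0..<Suc m]) :: 'a fls) ^ (q ^ n) = P ^ (q ^ n) / Q * z (Suc m) ^ (q ^ n)"
    by simp
  have X: "(mzeta ((q ^ (n + 1) - 1) # map t [n + 1..<n + Suc m]) :: 'a fls) = R / Q * z (n + Suc m)"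
    using Suc.IH[of "n + 1"] by (simp add: R_def Q_def z_def)
  have "carlitz_L (n + Suc m) = carlitz_L n * R * (bracket (n + Suc m) :: 'a fls)"
    using carlitz_L_add[of n m, where ?'a = 'a] by (simp add: carlitz_L_Suc R_def)
  moreover have "carlitz_L (Suc m) = P * (bracket (Suc m) :: 'a fls)"
    by (simp add: P_def carlitz_L_def)
  \<comment> \<open>The multiplicative relation for \<zeta>(q^k - 1), written out with L_(n+m+1) =
    L_n R [n+m+1] and L_(m+1) = P [m+1].\<close>
  ultimately have "carlitz_L n * (R * bracket (n + Suc m) * z (n + Suc m)) =
      carlitz_L n * (z n * P ^ (q ^ n) * B * z (Suc m) ^ (q ^ n))"
    using carlitz_L_mult_zeta_add[OF Suc.prems zero_less_Suc[of m], where ?'a = 'a]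
    unfolding q_def[symmetric] z_def[symmetric] B_def by (simp only: power_mult_distrib mult_ac)
  hence rel: "R * bracket (n + Suc m) * z (n + Suc m) = z n * P ^ (q ^ n) * B * z (Suc m) ^ (q ^ n)"
    using carlitz_L_nonzero[of n, where ?'a = 'a] by simp
  \<comment> \<open>Since [m+1]^(q^n) = \<theta>^(q^(n+m+1)) - \<theta>^(q^n), the highest powers
    cancel; this produces the new factor [n].\<close>
  have bn: "bracket n = bracket (n + Suc m) - B"
    by (simp add: B_def bracket_def q_def diff_power_card_power_fls power_add mult_ac flip: power_mult)
  have "bracket n * R * z (n + Suc m) = z n * P ^ (q ^ n) * B * z (Suc m) ^ (q ^ n) - B * R * z (n + Suc m)"
    unfolding rel[symmetric] bn by (simp only: algebra_simps)
  hence "z n * (P ^ (q ^ n) / Q * z (Suc m) ^ (q ^ n)) - R / Q * z (n + Suc m) =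
      bracket n * R / (Q * B) * z (n + Suc m)"
    using nz by (simp add: divide_simps) (simp only: mult_ac right_diff_distrib left_diff_distrib)
  hence "(mzeta ((q ^ n - 1) # map t [n..<n + Suc m]) :: 'a fls) = bracket n * R / (Q * B) * z (n + Suc m)"
    using zeta_mult_mzeta_powers[OF Suc.prems, of m, where ?'a = 'a] X Y
    unfolding q_def[symmetric] t_def z_def by simp
  moreover have "(\<Prod>j = n..<n + Suc m. bracket j :: 'a fls) = bracket n * R"
    unfolding R_def by (subst prod.atLeast_Suc_lessThan) simp_all
  moreover have "(\<Prod>k = 1..Suc m. bracket k ^ (q ^ (n + Suc m - k)) :: 'a fls) = Q * B"
    by (simp add: Q_def B_def)
  ultimately show ?case by (simp only: z_def)
qed


subsection \<open>The period\<close>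

text \<open>Index i stands for factor i + 1 in the period, as infinite products are indexed from
  0.\<close>

abbreviation carlitz_factor :: "nat \<Rightarrow> 'a::{field, finite} fls"
  where "carlitz_factor i \<equiv> inverse (1 - theta powi (1 - int CARD('a) ^ Suc i))"

lemma theta_nonzero [simp]: "theta \<noteq> (0 :: 'a::{field, finite} fls)"
  by (simp add: theta_def)

lemma val_ge_theta_powi: "val_ge (theta powi (1 - int CARD('a) ^ Suc i) :: 'a::{field, finite} fls) (int (Suc i))"
proof -
  have "Suc i < CARD('a) ^ Suc i"
    using card_field_gt_1[where ?'a = 'a] by (intro power_gt_expt) simp
  hence "int (Suc i) < int (CARD('a) ^ Suc i)" by (simp only: of_nat_less_iff)
  hence "fls_subdegree (theta powi (1 - int CARD('a) ^ Suc i) :: 'a fls) \<ge> int (Suc i)"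
    by (simp add: fls_subdegree_power_int theta_def)
  thus ?thesis by (simp add: val_ge_alt)
qed

lemma val_ge_inverse_one_minus:
  assumes "val_ge x 1"
  shows "val_ge (inverse (1 - x)) 0" "1 - x \<noteq> 0"
proof -
  have "fls_subdegree (1 - x) = 0"
    using assms by (intro fls_subdegree_eqI) (auto simp: val_ge_def)
  moreover have "fls_nth (1 - x) 0 \<noteq> 0" using assms by (simp add: val_ge_def)
  ultimately show "1 - x \<noteq> 0" "val_ge (inverse (1 - x)) 0"
    by (auto simp: val_ge_alt fls_inverse_subdegree)
qed

lemma one_minus_theta_powi_nonzero: "1 - theta powi (1 - int CARD('a) ^ Suc i) \<noteq> (0 :: 'a::{field, finite} fls)"
  by (rule val_ge_inverse_one_minus(2)[OF val_ge_mono[OF val_ge_theta_powi]]) simp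

lemma val_ge_carlitz_factor: "val_ge (carlitz_factor i :: 'a::{field, finite} fls) 0"
  by (rule val_ge_inverse_one_minus(1)[OF val_ge_mono[OF val_ge_theta_powi]]) simp

lemma val_ge_carlitz_factor_minus_1: "val_ge (carlitz_factor i - 1 :: 'a::{field, finite} fls) (int (Suc i))"
proof -
  have "carlitz_factor i - 1 = theta powi (1 - int CARD('a) ^ Suc i) * (carlitz_factor i :: 'a fls)"
    using one_minus_theta_powi_nonzero[of i, where ?'a = 'a] by (simp add: field_simps)
  thus ?thesis using val_ge_mult[OF val_ge_theta_powi val_ge_carlitz_factor, of i i] by simp
qed

text \<open>The factors tend to 1 and differ from 1 by positive valuation, so the partial products
  converge and keep constant coefficient 1. The limit is thus nonzero, as \<open>has_prod\<close>
  demands.\<close>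

lemma prodinf_carlitz_factor:
  defines "P \<equiv> (\<Prod>i. carlitz_factor i :: 'a::{field, finite} fls)"
  shows "(\<lambda>d. \<Prod>i<d. carlitz_factor i) \<longlonglongrightarrow> P" "P \<noteq> 0"
proof -
  define p where "p d = (\<Prod>i<d. carlitz_factor i :: 'a fls)" for d
  have p0: "val_ge (p d) 0" for d
    using val_ge_prod[of "{..<d}" "carlitz_factor :: nat \<Rightarrow> 'a fls" "\<lambda>_. 0", OF _ val_ge_carlitz_factor]
    by (simp add: p_def)
  have step: "val_ge (p (Suc d) - p d) (int (Suc d))" for d
  proof -
    have "p (Suc d) - p d = p d * (carlitz_factor d - 1)" by (simp add: p_def algebra_simps)
    thus ?thesis using val_ge_mult[OF p0[of d] val_ge_carlitz_factor_minus_1[of d]] by simp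
  qed
  have p1: "val_ge (p d - 1) 1" for d
  proof (induction d)
    case (Suc d)
    have "val_ge (p (Suc d) - p d) 1" by (rule val_ge_mono[OF step]) simp
    from val_ge_add[OF this Suc] show ?case by simp
  qed (simp add: p_def val_ge_def)
  obtain l where l: "p \<longlonglongrightarrow> l"
    using convergent_fls[of p] val_ge_mono[OF step] by auto
  have "l \<noteq> 0"
  proof
    assume "l = 0"
    have "\<forall>\<^sub>F d in sequentially. val_ge (p d - l) 1" using l unfolding tendsto_fls_iff by blast
    then obtain d where "val_ge (p d) 1" using \<open>l = 0\<close> by (auto simp: eventually_sequentially)
    hence "fls_nth (p d) 0 = 0" by (simp add: val_ge_def)
    moreover have "fls_nth (p d - 1) 0 = 0" using p1[of d] unfolding val_ge_def by simp
    ultimately show False by simp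
  qed
  have "(\<lambda>d. \<Prod>i\<le>d. carlitz_factor i) \<longlonglongrightarrow> l"
    using LIMSEQ_Suc[OF l] by (simp add: p_def lessThan_Suc_atMost)
  hence "carlitz_factor has_prod l"
    using \<open>l \<noteq> 0\<close> by (simp add: has_prod_def raw_has_prod_def)
  hence "P = l" unfolding P_def using has_prod_unique by metis
  thus "(\<lambda>d. \<Prod>i<d. carlitz_factor i) \<longlonglongrightarrow> P" "P \<noteq> 0"
    using l \<open>l \<noteq> 0\<close> by (simp_all add: p_def[abs_def])
qed

text \<open>In \<theta> - \<theta>^(q^i) = -\<theta>^(q^i) (1 - \<theta>^(1-q^i)) the last
  parenthesis is cancelled by the matching factor of the period.\<close>

lemma carlitz_ell_mult_prod_carlitz_factor:
  "carlitz_ell d * (\<Prod>i<d. carlitz_factor i) = (\<Prod>i<d. - (theta ^ (CARD('a) ^ Suc i)) :: 'a::{field, finite} fls)"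
proof (induction d)
  case (Suc d)
  have "theta powi (1 - int CARD('a) ^ Suc d) = (theta / theta ^ (CARD('a) ^ Suc d) :: 'a fls)"
    using power_int_diff[of theta 1 "int (CARD('a) ^ Suc d)"]
    unfolding power_int_of_nat by (simp del: power_Suc)
  hence "theta - theta ^ (CARD('a) ^ Suc d) =
      - (theta ^ (CARD('a) ^ Suc d)) * (1 - theta powi (1 - int CARD('a) ^ Suc d) :: 'a fls)"
    by (simp add: right_diff_distrib del: power_Suc)
  hence "(theta - theta ^ (CARD('a) ^ Suc d)) * carlitz_factor d = - (theta ^ (CARD('a) ^ Suc d) :: 'a fls)"
    using one_minus_theta_powi_nonzero[of d, where ?'a = 'a] by (simp add: mult.assoc del: power_Suc)
  moreover have "carlitz_ell (Suc d) * (\<Prod>i<Suc d. carlitz_factor i) =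
      carlitz_ell d * (\<Prod>i<d. carlitz_factor i) * ((theta - theta ^ (CARD('a) ^ Suc d)) * carlitz_factor d :: 'a fls)"
    by (simp only: carlitz_ell_Suc prod.lessThan_Suc mult_ac)
  ultimately show ?case using Suc by simp
qed simp

text \<open>The right-hand side is the (q-1)-st power of the period, written without the root of
  -\<theta> and hence inside the Laurent series, where limits can be taken.\<close>

lemma carlitz_ell_1_mult_zeta:
  "carlitz_ell 1 * zeta (CARD('a) - 1) =
    ((- theta) ^ CARD('a) * (\<Prod>i. carlitz_factor i) ^ (CARD('a) - 1) :: 'a::{field, finite} fls)"
proof -
  define q where "q = CARD('a)"
  define P :: "'a fls" where "P = (\<Prod>i. carlitz_factor i)"
  define p where "p d = (\<Prod>i<d. carlitz_factor i :: 'a fls)" for d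
  define v where "v d = (carlitz_ell (1 + d) / carlitz_ell d ^ q :: 'a fls)" for d
  define s where "s d = (\<Prod>i<d. - (theta ^ (q ^ Suc i)) :: 'a fls)" for d
  have P: "p \<longlonglongrightarrow> P" "P \<noteq> 0"
    using prodinf_carlitz_factor[where ?'a = 'a] by (simp_all add: P_def p_def[abs_def])
  have v: "v \<longlonglongrightarrow> carlitz_ell 1 * zeta (q - 1)"
    using zeta_card_power_minus_1_tendsto[of 1, where ?'a = 'a] by (simp add: v_def[abs_def] q_def)
  have neg: "(- x) ^ q = - (x ^ q)" for x :: "'a fls"
    using minus_power_card_power_fls[of x 1] by (simp add: q_def)
  \<comment> \<open>The first factor is -(\<theta>^q) = (-\<theta>)^q, and the later ones are the
    q-th powers of the factors of \<open>s d\<close>.\<close>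
  have s: "s (Suc d) = (- theta) ^ q * s d ^ q" for d
    unfolding s_def prod.lessThan_Suc_shift prod_power_distrib
    by (simp add: neg mult.commute flip: power_mult)
  have "v d * p (Suc d) = (- theta) ^ q * p d ^ q" for d
  proof -
    have "carlitz_ell (Suc d) * p (Suc d) = (- theta) ^ q * (carlitz_ell d * p d) ^ q"
      using carlitz_ell_mult_prod_carlitz_factor[where ?'a = 'a] s by (simp only: p_def s_def q_def)
    thus ?thesis using carlitz_ell_nonzero[of d, where ?'a = 'a]
      by (simp add: v_def power_mult_distrib field_simps)
  qed
  moreover have "(\<lambda>d. v d * p (Suc d)) \<longlonglongrightarrow> carlitz_ell 1 * zeta (q - 1) * P"
    by (intro tendsto_mult_fls v LIMSEQ_Suc P)
  moreover have "(\<lambda>d. (- theta) ^ q * p d ^ q) \<longlonglongrightarrow> (- theta) ^ q * P ^ q"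
    by (intro tendsto_mult_fls tendsto_power_fls tendsto_const P)
  ultimately have "carlitz_ell 1 * zeta (q - 1) * P = (- theta) ^ q * P ^ q"
    using LIMSEQ_unique by simp
  also have "\<dots> = (- theta) ^ q * P ^ (q - 1) * P"
    using power_minus_mult[of q P] by (simp add: q_def mult.assoc)
  finally show ?thesis using P(2) by (simp add: q_def P_def)
qed

text \<open>Induction on k: the splitting q^(k+1) - 1 = (q - 1) + (q^k - 1) q matches
  \<open>carlitz_ell_mult_zeta_add\<close> with n = 1.\<close>

lemma carlitz_period_power:
  fixes \<rho> :: "'a::{field, finite} fls alg_closure"
  assumes "\<rho> ^ (CARD('a) - 1) = to_ac (- theta)" "k > 0"
  shows "carlitz_period \<rho> ^ (CARD('a) ^ k - 1) = to_ac (carlitz_ell k * zeta (CARD('a) ^ k - 1))"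
proof -
  define q where "q = CARD('a)"
  have q: "q > 1" using card_field_gt_1 by (simp add: q_def)
  have "(\<rho> ^ CARD('a)) ^ (CARD('a) - 1) = to_ac ((- theta) ^ CARD('a))"
    unfolding to_ac_power assms(1)[symmetric] by (simp add: mult.commute flip: power_mult)
  hence base: "carlitz_period \<rho> ^ (q ^ 1 - 1) = to_ac (carlitz_ell 1 * zeta (q ^ 1 - 1))"
    unfolding carlitz_period_def power_one_right q_def carlitz_ell_1_mult_zeta to_ac_mult
      power_mult_distrib to_ac_power by simp
  have "carlitz_period \<rho> ^ (q ^ k - 1) = to_ac (carlitz_ell k * zeta (q ^ k - 1))"
    using assms(2)
  proof (induction k rule: nat_induct_non_zero)
    case 1
    show ?case by (rule base)
  next
    case (Suc k)
    have "q \<le> q * q ^ k" using q by simp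
    hence "q ^ Suc k - 1 = (q ^ 1 - 1) + (q ^ k - 1) * q"
      using q by (simp add: diff_mult_distrib2 mult.commute del: One_nat_def)
    hence "carlitz_period \<rho> ^ (q ^ Suc k - 1) =
        carlitz_period \<rho> ^ (q ^ 1 - 1) * (carlitz_period \<rho> ^ (q ^ k - 1)) ^ q"
      by (simp only: power_add power_mult)
    thus ?case
      unfolding base Suc.IH
      using carlitz_ell_mult_zeta_add[of 1 k, where ?'a = 'a] Suc.hyps by (simp add: q_def)
  qed
  thus ?thesis by (simp only: q_def)
qed

section \<open>Recursion and closed forms of the multizeta values\<close>

theorem theorem5p1:
  fixes q r n :: nat
  assumes q: "q = CARD('a::{field, finite})" and r: "r > 1" and n: "n \<ge> 1"
  shows
    "mzeta ((q ^ n - 1) # map (\<lambda>i. (q - 1) * q ^ i) [n..<n + r - 1]) =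
       (zeta (q ^ n - 1) * mzeta (map (\<lambda>i. (q - 1) * q ^ i) [0..<r - 1]) ^ (q ^ n)
        - mzeta ((q ^ (n + 1) - 1) # map (\<lambda>i. (q - 1) * q ^ i) [n + 1..<n + r - 1]) :: 'a fls)
     \<and> (\<forall>\<rho> :: 'a fls alg_closure. \<rho> ^ (q - 1) = to_ac (- theta) \<longrightarrow>
       to_ac (mzeta ((q ^ n - 1) # map (\<lambda>i. (q - 1) * q ^ i) [n..<n + r - 1])) =
       to_ac ((- 1) ^ (n + r - 1) * (\<Prod>j = n..n + r - 2. bracket j)
          / ((\<Prod>k = 1..r - 1. bracket k ^ (q ^ (n + r - 1 - k))) * carlitz_L (n + r - 1)))
       * carlitz_period \<rho> ^ (q ^ (n + r - 1) - 1))
     \<and> mzeta ((q ^ n - 1) # map (\<lambda>i. (q - 1) * q ^ i) [n..<n + r - 1]) =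
       ((\<Prod>j = n..n + r - 2. bracket j)
          / (\<Prod>k = 1..r - 1. bracket k ^ (q ^ (n + r - 1 - k)))
        * zeta (q ^ (n + r - 1) - 1) :: 'a fls)"
proof (intro conjI allI impI)
  obtain m where m: "r - 1 = Suc m" using r by (metis Suc_diff_Suc diff_Suc_1 One_nat_def)
  have nr: "n + r - 1 = n + Suc m" "{n..n + r - 2} = {n..<n + Suc m}" using m r by auto
  have n': "n > 0" using n by simp
  show "mzeta ((q ^ n - 1) # map (\<lambda>i. (q - 1) * q ^ i) [n..<n + r - 1]) =
       (zeta (q ^ n - 1) * mzeta (map (\<lambda>i. (q - 1) * q ^ i) [0..<r - 1]) ^ (q ^ n)
        - mzeta ((q ^ (n + 1) - 1) # map (\<lambda>i. (q - 1) * q ^ i) [n + 1..<n + r - 1]) :: 'a fls)"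
    unfolding q nr m by (rule zeta_mult_mzeta_powers[OF n'])
  show X: "mzeta ((q ^ n - 1) # map (\<lambda>i. (q - 1) * q ^ i) [n..<n + r - 1]) =
       ((\<Prod>j = n..n + r - 2. bracket j)
          / (\<Prod>k = 1..r - 1. bracket k ^ (q ^ (n + r - 1 - k)))
        * zeta (q ^ (n + r - 1) - 1) :: 'a fls)"
    unfolding q nr m by (rule mzeta_powers_eq[OF n'])
  fix \<rho> :: "'a fls alg_closure"
  assume \<rho>: "\<rho> ^ (q - 1) = to_ac (- theta)"
  define N where "N = n + r - 1"
  have "carlitz_period \<rho> ^ (q ^ N - 1) = to_ac (carlitz_ell N * zeta (q ^ N - 1))"
    using carlitz_period_power[of \<rho> N] \<rho> n r by (simp add: q N_def)
  \<comment> \<open>\<open>carlitz_ell N\<close> is (-1)^N L_N, so the two signs cancel, and so does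
    L_N.\<close>
  moreover have "a / b * z = (- 1) ^ N * a / (b * carlitz_L N) * (carlitz_ell N * z)" for a b z :: "'a fls"
    using carlitz_L_nonzero[of N, where ?'a = 'a]
    by (simp add: carlitz_ell_eq_carlitz_L flip: power_mult_distrib mult.assoc)
  ultimately show "to_ac (mzeta ((q ^ n - 1) # map (\<lambda>i. (q - 1) * q ^ i) [n..<n + r - 1])) =
       to_ac ((- 1) ^ (n + r - 1) * (\<Prod>j = n..n + r - 2. bracket j)
          / ((\<Prod>k = 1..r - 1. bracket k ^ (q ^ (n + r - 1 - k))) * carlitz_L (n + r - 1)))
       * carlitz_period \<rho> ^ (q ^ (n + r - 1) - 1)"
    unfolding X unfolding N_def[symmetric] by (simp only: to_ac_mult[symmetric])
qed

end
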